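(* Let $X$ be a finite set of clocks, $Y=X\cup\{\zeta\}$ with $\zeta\notin X$, and let $k\ge1$ and $n>1$. Every simple TCW that is $k$-round well-timed with respect to the clocks $Y$ and the $n$ stacks $1,\dots,n$ has split-width at most $$K=\max\bigl(kn+2(kn-1)|Y|,\ (k+2)(2|Y|+1)\bigr).$$
   Context: Fix a finite alphabet $\Sigma$, $\Sigma_\varepsilon=\Sigma\cup\{\varepsilon\}$, and a finite set $\mathcal{I}$ of closed intervals with bounds in $\mathbb{N}\cup\{\infty\}$. **TCW.** A word with timing constraints (TCW) is $\mathcal{V}=(V,\to,(\curvearrowright^I)_{I\in\mathcal{I}},\lambda)$ where $V$ is a finite set, $\lambda:V\to\Sigma_\varepsilon$, $\leq\;=\;\to^*$ is a total order on $V$ whose direct-successor relation is $\to$ (also written $\lessdot$), and $\curvearrowright^I\subseteq{<}$ for each $I$. Write $\curvearrowright=\bigcup_I\curvearrowright^I$. It is simple if each position is an endpoint (source or target) of at most one timing constraint. **$k$-round well-timed.** A simple TCW is $k$-round well-timed with respect to clocks $Y$ and stacks $1\le s\le n$ if for each $I$ one can partition $\curvearrowright^I=\biguplus_{1\le s\le n}\curvearrowright^{s\in I}\uplus\biguplus_{x\in Y}\curvearrowright^{x\in I}$ so that, with $\curvearrowright^s=\bigcup_I\curvearrowright^{s\in I}$ and $\curvearrowright^x=\bigcup_I\curvearrowright^{x\in I}$: - for each stack $s$, $\curvearrowright^s$ is well-nested: if $i\curvearrowright^sj$, $i'\curvearrowright^sj'$ and $i<i'<j$ then $i'<j'<j$.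 Moreover $V=V_1\uplus\cdots\uplus V_k$ with $V_i\times V_j\subseteq{<}$ for $i<j$, and each $V_\ell=V_\ell^1\uplus\cdots\uplus V_\ell^n$ with $V_\ell^s\times V_\ell^t\subseteq{<}$ for $s<t$, such that all push/pop events in $V_\ell^s$ are on stack $s$ (i.e. for all $i\curvearrowright^tj$ with $t\ne s$, $i,j\notin V_\ell^s$); - an $x$-reset block is a maximal sequence of consecutive positions $i_1\lessdot\cdots\lessdot i_m$ all in the domain of $\curvearrowright^x$. For each $x\in Y$ and all $i\curvearrowright^xj$, $i'\curvearrowright^xj'$ with $i<i'$: if $i,i'$ are in the same $x$-reset block then $i<i'<j'<j$; if they are not in the same $x$-reset block then $j<i'$. **Split-width.** A split-TCW is a TCW in which the successor relation is partitioned into present edges $\to$ and absent edges (holes) $\dashrightarrow$. Blocks are maximal sets of points connected by $\to$; the width is the number of blocks. A TCW is a split-TCW of width 1. A split-TCW is atomic if it is a single point, or two points $p_1\dashrightarrow p_2$ with one timing constraint $p_1\curvearrowright^Ip_2$. "Connected" means connected with respect to $\to\cup\curvearrowright$. A split-tree for $\mathcal{V}$ is a finite binary tree labelled by split-TCWs such that: the root is labelled $\mathcal{V}$; leaves are labelled by atomic split-TCWs; a unary node is labelled by a connected split-TCW and its child by the split-TCW obtained by turning one $\to$ edge into a hole; a binary node is labelled by a disconnected split-TCW which is the disjoint union $\mathcal{V}_1\uplus\mathcal{V}_2$ of the labels of its children (each $\mathcal{V}_i$ being a union of connected components with the inherited order, consecutive blocks being separated by holes). The width of a split-tree is the maximum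 width of its labels; the split-width of a simple (split-)TCW is the minimum width of a split-tree for it. *)

theory Defs
  imports "HOL-Library.Extended_Real" "HOL-Library.Disjoint_Sets"
begin

section \<open>Words with timing constraints\<close>

text \<open>Either bound may be infinite; an interval is identified with the set of real delays it
  admits, so \<open>{l..\<infinity>}\<close> becomes the half-line from \<open>l\<close>.\<close>

definition closed_interval :: "real set \<Rightarrow> bool" where
  "closed_interval I \<longleftrightarrow>
     (\<exists>l u :: enat. l \<le> u \<and> I = {t. ereal_of_enat l \<le> ereal t \<and> ereal t \<le> ereal_of_enat u})"

text \<open>In \<open>lab\<close>, \<open>None\<close> is the empty word \<open>\<epsilon>\<close>; values of \<open>lab\<close> outside \<open>verts\<close> are irrelevant.\<close>

record ('v, 'a) tcw =
  verts :: "'v set"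
  succ :: "('v \<times> 'v) set"
  constr :: "real set \<Rightarrow> ('v \<times> 'v) set"
  lab :: "'v \<Rightarrow> 'a option"

definition le :: "('v, 'a, 'z) tcw_scheme \<Rightarrow> ('v \<times> 'v) set" where
  "le W = (succ W)\<^sup>* \<inter> verts W \<times> verts W"

definition lt :: "('v, 'a, 'z) tcw_scheme \<Rightarrow> ('v \<times> 'v) set" where
  "lt W = le W - Id"

definition direct_succ :: "('v \<times> 'v) set \<Rightarrow> ('v \<times> 'v) set" where
  "direct_succ r = {(u, v). (u, v) \<in> r \<and> u \<noteq> v \<and>
     \<not> (\<exists>w. w \<noteq> u \<and> w \<noteq> v \<and> (u, w) \<in> r \<and> (w, v) \<in> r)}"

text \<open>The family of constraint relations is indexed by \<open>\<I>\<close>; it is extended by the empty relation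
  to all other sets. Words are nonempty, since a TCW is to be a split-TCW with exactly one block
  (the empty structure has no split-tree).\<close>

definition is_tcw :: "'a set \<Rightarrow> real set set \<Rightarrow> ('v, 'a, 'z) tcw_scheme \<Rightarrow> bool" where
  "is_tcw \<Sigma> \<I> W \<longleftrightarrow>
     finite (verts W) \<and> verts W \<noteq> {} \<and>
     (\<forall>v\<in>verts W. lab W v \<in> insert None (Some ` \<Sigma>)) \<and>
     linear_order_on (verts W) (le W) \<and>
     succ W = direct_succ (le W) \<and>
     (\<forall>I\<in>\<I>. constr W I \<subseteq> lt W) \<and>
     (\<forall>I. I \<notin> \<I> \<longrightarrow> constr W I = {})"

definition all_constr :: "('v, 'a, 'z) tcw_scheme \<Rightarrow> ('v \<times> 'v) set" where
  "all_constr W = (\<Union>I. constr W I)"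

text \<open>A timing constraint is a triple of source, interval and target: two different intervals on
  the same pair of positions count as two constraints.\<close>

definition simple_tcw :: "('v, 'a, 'z) tcw_scheme \<Rightarrow> bool" where
  "simple_tcw W \<longleftrightarrow>
     (\<forall>v\<in>verts W. \<forall>i I j i' I' j'.
        (i, j) \<in> constr W I \<and> v \<in> {i, j} \<and> (i', j') \<in> constr W I' \<and> v \<in> {i', j'} \<longrightarrow>
        (i, I, j) = (i', I', j'))"


section \<open>Round-bounded well-timed words\<close>

definition well_nested :: "('v, 'a, 'z) tcw_scheme \<Rightarrow> ('v \<times> 'v) set \<Rightarrow> bool" where
  "well_nested W R \<longleftrightarrow>
     (\<forall>i j i' j'. (i, j) \<in> R \<and> (i', j') \<in> R \<and> (i, i') \<in> lt W \<and> (i', j) \<in> lt W \<longrightarrow>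
        (i', j') \<in> lt W \<and> (j', j) \<in> lt W)"

text \<open>\<open>R s\<close> is the relation of stack \<open>s\<close>, \<open>U l\<close> is the round \<open>l\<close>, and \<open>P l s\<close> its phase for
  stack \<open>s\<close>. Rounds and phases may be empty.\<close>

definition k_round :: "('v, 'a, 'z) tcw_scheme \<Rightarrow> nat \<Rightarrow> nat \<Rightarrow> (nat \<Rightarrow> ('v \<times> 'v) set) \<Rightarrow> bool" where
  "k_round W k n R \<longleftrightarrow>
     (\<exists>U P.
        verts W = (\<Union>l\<in>{1..k}. U l) \<and> disjoint_family_on U {1..k} \<and>
        (\<forall>l\<in>{1..k}. \<forall>m\<in>{1..k}. l < m \<longrightarrow> U l \<times> U m \<subseteq> lt W) \<and>
        (\<forall>l\<in>{1..k}.
           U l = (\<Union>s\<in>{1..n}. P l s) \<and> disjoint_family_on (P l) {1..n} \<and>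
           (\<forall>s\<in>{1..n}. \<forall>t\<in>{1..n}. s < t \<longrightarrow> P l s \<times> P l t \<subseteq> lt W) \<and>
           (\<forall>s\<in>{1..n}. \<forall>t\<in>{1..n}. t \<noteq> s \<longrightarrow>
              (\<forall>(i, j)\<in>R t. i \<notin> P l s \<and> j \<notin> P l s))))"

definition reset_block :: "('v, 'a, 'z) tcw_scheme \<Rightarrow> ('v \<times> 'v) set \<Rightarrow> 'v list \<Rightarrow> bool" where
  "reset_block W R b \<longleftrightarrow>
     b \<noteq> [] \<and> successively (\<lambda>u v. (u, v) \<in> succ W) b \<and> set b \<subseteq> Domain R \<and>
     (\<forall>u. (u, hd b) \<in> succ W \<longrightarrow> u \<notin> Domain R) \<and>
     (\<forall>v. (last b, v) \<in> succ W \<longrightarrow> v \<notin> Domain R)"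

definition same_reset_block ::
  "('v, 'a, 'z) tcw_scheme \<Rightarrow> ('v \<times> 'v) set \<Rightarrow> 'v \<Rightarrow> 'v \<Rightarrow> bool" where
  "same_reset_block W R i i' \<longleftrightarrow> (\<exists>b. reset_block W R b \<and> i \<in> set b \<and> i' \<in> set b)"

definition clock_timed :: "('v, 'a, 'z) tcw_scheme \<Rightarrow> ('v \<times> 'v) set \<Rightarrow> bool" where
  "clock_timed W R \<longleftrightarrow>
     (\<forall>i j i' j'. (i, j) \<in> R \<and> (i', j') \<in> R \<and> (i, i') \<in> lt W \<longrightarrow>
        (if same_reset_block W R i i'
         then (i', j') \<in> lt W \<and> (j', j) \<in> lt W
         else (j, i') \<in> lt W))"

text \<open>\<open>Q (Inl s) I\<close> and \<open>Q (Inr x) I\<close> are the constraints with interval \<open>I\<close> attributed to the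
  stack \<open>s\<close> and to the clock \<open>x\<close>, respectively.\<close>

definition k_round_well_timed ::
  "('v, 'a, 'z) tcw_scheme \<Rightarrow> nat \<Rightarrow> 'c set \<Rightarrow> nat \<Rightarrow> bool" where
  "k_round_well_timed W k Y n \<longleftrightarrow>
     (\<exists>Q :: nat + 'c \<Rightarrow> real set \<Rightarrow> ('v \<times> 'v) set.
        (\<forall>I. constr W I = (\<Union>z\<in>{1..n} <+> Y. Q z I) \<and>
             disjoint_family_on (\<lambda>z. Q z I) ({1..n} <+> Y)) \<and>
        (\<forall>s\<in>{1..n}. well_nested W (\<Union>I. Q (Inl s) I)) \<and>
        k_round W k n (\<lambda>s. \<Union>I. Q (Inl s) I) \<and>
        (\<forall>x\<in>Y. clock_timed W (\<Union>I. Q (Inr x) I)))"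


section \<open>Split-width\<close>

record ('v, 'a) split_tcw = "('v, 'a) tcw" +
  hole :: "('v \<times> 'v) set"

definition is_split_tcw :: "'a set \<Rightarrow> real set set \<Rightarrow> ('v, 'a) split_tcw \<Rightarrow> bool" where
  "is_split_tcw \<Sigma> \<I> S \<longleftrightarrow> is_tcw \<Sigma> \<I> S \<and> hole S \<subseteq> succ S"

definition edge :: "('v, 'a) split_tcw \<Rightarrow> ('v \<times> 'v) set" where
  "edge S = succ S - hole S"

definition split_of_tcw :: "('v, 'a) tcw \<Rightarrow> ('v, 'a) split_tcw" where
  "split_of_tcw W =
     \<lparr>verts = verts W, succ = succ W, constr = constr W, lab = lab W, hole = {}\<rparr>"

definition components :: "'v set \<Rightarrow> ('v \<times> 'v) set \<Rightarrow> 'v set set" where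
  "components V E = V // ((E \<union> E\<inverse>)\<^sup>* \<inter> V \<times> V)"

definition blocks :: "('v, 'a) split_tcw \<Rightarrow> 'v set set" where
  "blocks S = components (verts S) (edge S)"

definition width :: "('v, 'a) split_tcw \<Rightarrow> nat" where
  "width S = card (blocks S)"

definition split_components :: "('v, 'a) split_tcw \<Rightarrow> 'v set set" where
  "split_components S = components (verts S) (edge S \<union> all_constr S)"

definition split_connected :: "('v, 'a) split_tcw \<Rightarrow> bool" where
  "split_connected S \<longleftrightarrow> card (split_components S) = 1"

definition atomic :: "('v, 'a) split_tcw \<Rightarrow> bool" where
  "atomic S \<longleftrightarrow>
     (\<exists>p. verts S = {p} \<and> succ S = {} \<and> all_constr S = {}) \<or>
     (\<exists>p\<^sub>1 p\<^sub>2 I. p\<^sub>1 \<noteq> p\<^sub>2 \<and> verts S = {p\<^sub>1, p\<^sub>2} \<and> succ S = {(p\<^sub>1, p\<^sub>2)} \<and> hole S = {(p\<^sub>1, p\<^sub>2)} \<and>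
        constr S I = {(p\<^sub>1, p\<^sub>2)} \<and> (\<forall>J. J \<noteq> I \<longrightarrow> constr S J = {}))"

definition cut :: "('v, 'a) split_tcw \<Rightarrow> ('v, 'a) split_tcw \<Rightarrow> bool" where
  "cut S S' \<longleftrightarrow> (\<exists>e\<in>edge S. S' = S\<lparr>hole := insert e (hole S)\<rparr>)"

text \<open>The substructure on \<open>C\<close>, with the inherited order. Positions that become neighbours only
  because something between them was left out are separated by a hole.\<close>

definition induced :: "('v, 'a) split_tcw \<Rightarrow> 'v set \<Rightarrow> ('v, 'a) split_tcw" where
  "induced S C =
     S\<lparr>verts := C,
       succ := direct_succ (le S \<inter> C \<times> C),
       constr := (\<lambda>I. constr S I \<inter> C \<times> C),
       hole := direct_succ (le S \<inter> C \<times> C) - edge S\<rparr>"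

definition is_disjoint_union ::
  "('v, 'a) split_tcw \<Rightarrow> ('v, 'a) split_tcw \<Rightarrow> ('v, 'a) split_tcw \<Rightarrow> bool" where
  "is_disjoint_union S S\<^sub>1 S\<^sub>2 \<longleftrightarrow>
     (\<exists>C\<^sub>1 C\<^sub>2. C\<^sub>1 \<noteq> {} \<and> C\<^sub>2 \<noteq> {} \<and> C\<^sub>1 \<inter> C\<^sub>2 = {} \<and> C\<^sub>1 \<union> C\<^sub>2 = split_components S \<and>
        S\<^sub>1 = induced S (\<Union>C\<^sub>1) \<and> S\<^sub>2 = induced S (\<Union>C\<^sub>2))"

datatype (labels: 's) split_tree =
    Leaf (root: 's)
  | Unary (root: 's) "'s split_tree"
  | Binary (root: 's) "'s split_tree" "'s split_tree"

primrec decomposes :: "('v, 'a) split_tcw split_tree \<Rightarrow> bool" where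
  "decomposes (Leaf S) \<longleftrightarrow> atomic S"
| "decomposes (Unary S t) \<longleftrightarrow> split_connected S \<and> cut S (root t) \<and> decomposes t"
| "decomposes (Binary S t\<^sub>1 t\<^sub>2) \<longleftrightarrow>
     \<not> split_connected S \<and> is_disjoint_union S (root t\<^sub>1) (root t\<^sub>2) \<and>
     decomposes t\<^sub>1 \<and> decomposes t\<^sub>2"

definition is_split_tree_for ::
  "'a set \<Rightarrow> real set set \<Rightarrow> ('v, 'a) split_tcw \<Rightarrow> ('v, 'a) split_tcw split_tree \<Rightarrow> bool" where
  "is_split_tree_for \<Sigma> \<I> S t \<longleftrightarrow>
     root t = S \<and> (\<forall>L\<in>labels t. is_split_tcw \<Sigma> \<I> L) \<and> decomposes t"

definition tree_width :: "('v, 'a) split_tcw split_tree \<Rightarrow> nat" where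
  "tree_width t = Max (width ` labels t)"

text \<open>The infimum in \<^typ>\<open>enat\<close> is a minimum unless there is no split-tree at all, in which case
  it is \<open>\<infinity>\<close>.\<close>

definition split_width :: "'a set \<Rightarrow> real set set \<Rightarrow> ('v, 'a) split_tcw \<Rightarrow> enat" where
  "split_width \<Sigma> \<I> S = (INF t\<in>{t. is_split_tree_for \<Sigma> \<I> S t}. enat (tree_width t))"

end

theory Submission
  imports Defs
begin

text \<open>Read each position as belonging to the place of its target if it is the source of a clock
  constraint, and to its own place otherwise. A set \<open>J\<close> of positions then claims the preimage of \<open>J\<close>,
  and no clock constraint leaves a claimed set. The constraints of one clock that cross a given point
  start in a prefix of a single reset block. So for every interval of \<open>J\<close>, each clock contributes at
  most one hole (sources given away to the right) and one extra block (sources claimed from the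
  left), and if \<open>J\<close> consists of \<open>m\<close> intervals, the claimed set has at most \<open>m (2|Y| + 1)\<close> blocks.

  Splitting the word into the sets claimed by the phases of each stack costs at most
  \<open>kn + 2(kn - 1)|Y|\<close> blocks, since nothing is claimed from before the first or after the last
  phase. The phases of one stack form at most \<open>k\<close> intervals, and from these one repeatedly detaches
  the last position: if it closes a stack constraint \<open>(i, j)\<close>, well-nestedness separates the positions
  before \<open>i\<close> from those between \<open>i\<close> and \<open>j\<close>, which together form at most \<open>k + 1\<close> intervals.\<close>

section \<open>Orders and components\<close>

text \<open>Orders are given by a numbering, so that betweenness and direct successors become
  arithmetic and every subset inherits its order from the same \<open>r\<close>.\<close>

definition rank_order :: "('v \<Rightarrow> nat) \<Rightarrow> 'v set \<Rightarrow> ('v \<times> 'v) set" where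
  "rank_order r C = {(u, v). u \<in> C \<and> v \<in> C \<and> r u \<le> r v}"

lemma rank_order_Int: "D \<subseteq> C \<Longrightarrow> rank_order r C \<inter> D \<times> D = rank_order r D"
  by (auto simp: rank_order_def)

lemma linear_order_rank_order:
  assumes "inj_on r C"
  shows "linear_order_on C (rank_order r C)"
  using assms unfolding order_on_defs refl_on_def trans_def antisym_def total_on_def rank_order_def
  by (auto dest: inj_onD)

lemma direct_succ_rank_order:
  assumes "inj_on r C"
  shows "(u, v) \<in> direct_succ (rank_order r C) \<longleftrightarrow>
    u \<in> C \<and> v \<in> C \<and> r u < r v \<and> (\<forall>w\<in>C. \<not> (r u < r w \<and> r w < r v))"
  using assms unfolding direct_succ_def rank_order_def
  by (auto dest: inj_onD simp: order.strict_iff_order)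

text \<open>Induction on the difference of the ranks: a point strictly between splits the pair, and
  without one the pair is equal or a direct successor. The order of a label is computed from its
  successor relation; this identifies it with the inherited order.\<close>

lemma rtrancl_direct_succ_rank_order:
  assumes inj: "inj_on r C"
  shows "(direct_succ (rank_order r C))\<^sup>* \<inter> C \<times> C = rank_order r C"
proof -
  have "r u \<le> r v" if "(u, v) \<in> (direct_succ (rank_order r C))\<^sup>*" for u v
    using that by induction (auto simp: direct_succ_rank_order[OF inj])
  moreover have "(u, v) \<in> (direct_succ (rank_order r C))\<^sup>*"
    if "u \<in> C" "v \<in> C" "r u \<le> r v" for u v
    using that
  proof (induction "r v - r u" arbitrary: u v rule: less_induct)
    case less
    show ?case
    proof (cases "\<exists>w\<in>C. r u < r w \<and> r w < r v")
      case True
      then obtain w where w: "w \<in> C" "r u < r w" "r w < r v" by blast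
      have "(u, w) \<in> (direct_succ (rank_order r C))\<^sup>*"
        using less.hyps[of w u] less.prems w by auto
      moreover have "(w, v) \<in> (direct_succ (rank_order r C))\<^sup>*"
        using less.hyps[of v w] less.prems w by auto
      ultimately show ?thesis by (rule rtrancl_trans)
    next
      case False
      show ?thesis
      proof (cases "u = v")
        case False
        then have "r u < r v" using less.prems inj by (metis inj_onD le_neq_implies_less)
        then have "(u, v) \<in> direct_succ (rank_order r C)"
          using less.prems \<open>\<not> (\<exists>w\<in>C. _ w)\<close> by (auto simp: direct_succ_rank_order[OF inj])
        then show ?thesis by blast
      qed simp
    qed
  qed
  ultimately show ?thesis unfolding rank_order_def by auto
qed

text \<open>Counting strict predecessors is strictly monotone, hence injective with values below
  \<open>card V\<close>, and these values are then exhausted by cardinality.\<close>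

lemma finite_linear_order_rank:
  assumes fin: "finite V" and lin: "linear_order_on V R"
  obtains r where "bij_betw r V {..<card V}" "R = rank_order r V"
proof -
  define r where "r v = card {u. (u, v) \<in> R \<and> u \<noteq> v}" for v
  have sub: "R \<subseteq> V \<times> V" and refl: "\<And>v. v \<in> V \<Longrightarrow> (v, v) \<in> R"
    and trans: "\<And>u v w. (u, v) \<in> R \<Longrightarrow> (v, w) \<in> R \<Longrightarrow> (u, w) \<in> R"
    and anti: "\<And>u v. (u, v) \<in> R \<Longrightarrow> (v, u) \<in> R \<Longrightarrow> u = v"
    and total: "\<And>u v. u \<in> V \<Longrightarrow> v \<in> V \<Longrightarrow> u \<noteq> v \<Longrightarrow> (u, v) \<in> R \<or> (v, u) \<in> R"
    using lin unfolding order_on_defs refl_on_def trans_def antisym_def total_on_def by blast+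
  have below: "{u. (u, v) \<in> R \<and> u \<noteq> v} \<subseteq> V" for v using sub by auto
  then have finb: "finite {u. (u, v) \<in> R \<and> u \<noteq> v}" for v using fin finite_subset by blast
  have less: "r u < r v" if "(u, v) \<in> R" "u \<noteq> v" for u v
    unfolding r_def using that by (intro psubset_card_mono[OF finb]) (auto dest: trans anti)
  have inj: "inj_on r V"
    by (rule inj_onI) (metis less total nat_neq_iff)
  have "r ` V \<subseteq> {..<card V}"
    unfolding r_def using below by (auto intro!: psubset_card_mono[OF fin])
  then have "r ` V = {..<card V}"
    using card_image[OF inj] by (intro card_subset_eq) auto
  with inj have "bij_betw r V {..<card V}" by (simp add: bij_betw_def)
  moreover have "R = rank_order r V"
    unfolding rank_order_def using sub refl less total
    by (auto simp: order.strict_iff_order) (metis less not_le le_neq_implies_less order.strict_iff_order)+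
  ultimately show ?thesis by (rule that)
qed

text \<open>Every block has a first point, which has no incoming edge, so the heads bound the width.\<close>

definition heads :: "'v set \<Rightarrow> ('v \<times> 'v) set \<Rightarrow> 'v set" where
  "heads C E = C - snd ` E"

section \<open>Components, closed sets and connectedness\<close>

lemma equiv_components: "equiv V ((E \<union> E\<inverse>)\<^sup>* \<inter> V \<times> V)"
proof (rule equivI)
  have "sym ((E \<union> E\<inverse>)\<^sup>*)" by (intro sym_rtrancl) (auto simp: sym_def)
  then show "sym ((E \<union> E\<inverse>)\<^sup>* \<inter> V \<times> V)" by (auto simp: sym_def)
qed (auto simp: refl_on_def trans_def)

lemma card_components_le_heads:
  fixes r :: "'v \<Rightarrow> nat"
  assumes "finite V" and sub: "E \<subseteq> V \<times> V" and less: "\<And>u v. (u, v) \<in> E \<Longrightarrow> r u < r v"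
  shows "card (components V E) \<le> card (heads V E)"
proof -
  let ?R = "(E \<union> E\<inverse>)\<^sup>* \<inter> V \<times> V"
  have "\<exists>h\<in>heads V E. c = ?R `` {h}" if c: "c \<in> components V E" for c
  proof -
    obtain v where v: "v \<in> V" "c = ?R `` {v}"
      using c unfolding components_def by (rule quotientE)
    then have "v \<in> c" by auto
    \<comment> \<open>A member of least rank represents the component: an edge into it would start
      at a smaller member.\<close>
    then obtain h where h: "h \<in> c" and min: "\<And>u. u \<in> c \<Longrightarrow> r h \<le> r u"
      using ex_has_least_nat[of "\<lambda>u. u \<in> c" v r] by blast
    have "h \<notin> snd ` E"
    proof
      assume "h \<in> snd ` E"
      then obtain u where u: "(u, h) \<in> E" by auto
      then have "(h, u) \<in> (E \<union> E\<inverse>)\<^sup>*" "u \<in> V" using sub by auto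
      then have "u \<in> c" using h v by (auto intro: rtrancl_trans)
      then show False using min less[OF u] by fastforce
    qed
    moreover have "c = ?R `` {h}"
      using h v equiv_class_eq[OF equiv_components[of V E], of v h] by auto
    moreover have "h \<in> V" using h v by auto
    ultimately show ?thesis unfolding heads_def by blast
  qed
  then have "components V E \<subseteq> (\<lambda>h. ?R `` {h}) ` heads V E" by blast
  moreover have "finite (heads V E)" using assms by (simp add: heads_def)
  ultimately show ?thesis by (rule surj_card_le[rotated])
qed

text \<open>Among the subsets of a carrier of \<open>R\<close>, these are the unions of connected
  components, described without quotients.\<close>

definition closed_in :: "('v \<times> 'v) set \<Rightarrow> 'v set \<Rightarrow> bool" where
  "closed_in R D \<longleftrightarrow> (\<forall>(u, v)\<in>R. u \<in> D \<longleftrightarrow> v \<in> D)"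

lemma closed_in_rtrancl:
  assumes "closed_in R D" "(u, v) \<in> (R \<union> R\<inverse>)\<^sup>*"
  shows "u \<in> D \<longleftrightarrow> v \<in> D"
  using assms(2) by induction (use assms(1) in \<open>auto simp: closed_in_def\<close>)

lemma closed_in_trans:
  assumes "closed_in R D" "D' \<subseteq> D" "closed_in (R \<inter> D \<times> D) D'"
  shows "closed_in R D'"
  unfolding closed_in_def
proof safe
  fix u v assume R: "(u, v) \<in> R"
  have iff: "u \<in> D \<longleftrightarrow> v \<in> D" using R assms(1) by (auto simp: closed_in_def)
  have "u \<in> D' \<longleftrightarrow> v \<in> D'" if "u \<in> D" "v \<in> D"
    using R that assms(3) by (auto simp: closed_in_def)
  with iff assms(2) show "u \<in> D' \<Longrightarrow> v \<in> D'" "v \<in> D' \<Longrightarrow> u \<in> D'" by blast+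
qed

text \<open>A class never leaves a closed set that contains one of its points, so each class falls
  within one of the two parts.\<close>

lemma components_closed_partition:
  assumes V: "V = D1 \<union> D2" and cl: "closed_in R D1" "closed_in R D2"
  shows "\<Union> {c \<in> components V R. c \<subseteq> D1} = D1"
    and "components V R = {c \<in> components V R. c \<subseteq> D1} \<union> {c \<in> components V R. c \<subseteq> D2}"
proof -
  let ?R = "(R \<union> R\<inverse>)\<^sup>* \<inter> V \<times> V"
  have cls: "?R `` {v} \<subseteq> D" if "v \<in> D" "closed_in R D" for v D
    using closed_in_rtrancl[OF that(2)] that(1) by auto
  have mem: "v \<in> V \<Longrightarrow> v \<in> ?R `` {v} \<and> ?R `` {v} \<in> components V R" for v
    unfolding components_def by (auto intro: quotientI)
  have "v \<in> \<Union> {c \<in> components V R. c \<subseteq> D1}" if "v \<in> D1" for v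
    using mem[of v] cls[OF that cl(1)] that V by (intro UnionI[of "?R `` {v}"]) auto
  then show "\<Union> {c \<in> components V R. c \<subseteq> D1} = D1" by blast
  have "c \<subseteq> D1 \<or> c \<subseteq> D2" if "c \<in> components V R" for c
    using that unfolding components_def
  proof (rule quotientE)
    fix v assume "v \<in> V" "c = ?R `` {v}"
    then show ?thesis using cls[OF _ cl(1), of v] cls[OF _ cl(2), of v] V by auto
  qed
  then show "components V R = {c \<in> components V R. c \<subseteq> D1} \<union> {c \<in> components V R. c \<subseteq> D2}"
    by blast
qed

lemma empty_notin_components: "{} \<notin> components V R"
  unfolding components_def using in_quotient_imp_non_empty[OF equiv_components] by blast

text \<open>A class and its complement are both closed, so the hypothesis makes every class the
  whole carrier.\<close>

lemma card_components_eq_1: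
  assumes "V \<noteq> {}" and conn: "\<And>D. D \<subseteq> V \<Longrightarrow> closed_in R D \<Longrightarrow> closed_in R (V - D) \<Longrightarrow> D = {} \<or> D = V"
    and sub: "R \<subseteq> V \<times> V"
  shows "card (components V R) = 1"
proof -
  let ?R = "(R \<union> R\<inverse>)\<^sup>* \<inter> V \<times> V"
  have "?R `` {v} = V" if "v \<in> V" for v
  proof -
    have "closed_in R (?R `` {v})"
      unfolding closed_in_def using sub
      by (auto intro: rtrancl_into_rtrancl)
    moreover from this have "closed_in R (V - ?R `` {v})"
      using sub unfolding closed_in_def by blast
    ultimately show ?thesis using conn[of "?R `` {v}"] that by blast
  qed
  then have "components V R = {V}"
    using \<open>V \<noteq> {}\<close> unfolding components_def quotient_def by auto
  then show ?thesis by simp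
qed

section \<open>Split-trees from unrestricted decompositions\<close>

text \<open>All labels of the trees built here are substructures of the one word \<open>W\<close>.
  Order and constraints are inherited, so points and present edges determine the label.\<close>

definition state :: "('v, 'a) tcw \<Rightarrow> 'v set \<Rightarrow> ('v \<times> 'v) set \<Rightarrow> ('v, 'a) split_tcw" where
  "state W C E =
     \<lparr>verts = C, succ = direct_succ (le W \<inter> C \<times> C), constr = (\<lambda>I. constr W I \<inter> C \<times> C),
      lab = lab W, hole = direct_succ (le W \<inter> C \<times> C) - E\<rparr>"

lemma state_simps [simp]:
  "verts (state W C E) = C"
  "succ (state W C E) = direct_succ (le W \<inter> C \<times> C)"
  "constr (state W C E) = (\<lambda>I. constr W I \<inter> C \<times> C)"
  "lab (state W C E) = lab W"
  "hole (state W C E) = direct_succ (le W \<inter> C \<times> C) - E"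
  by (simp_all add: state_def)

lemma all_constr_state [simp]: "all_constr (state W C E) = all_constr W \<inter> C \<times> C"
  by (auto simp: all_constr_def)

text \<open>Decompositions into atoms in which disconnected structures may be cut, too; \<open>E\<close> is the set of
  present edges. The connectedness condition on unary nodes is recovered in \<open>has_tree_closed\<close>.\<close>

inductive splits :: "('v, 'a) tcw \<Rightarrow> nat \<Rightarrow> 'v set \<Rightarrow> ('v \<times> 'v) set \<Rightarrow> bool" for W K where
  point: "p \<in> verts W \<Longrightarrow> 1 \<le> K \<Longrightarrow> splits W K {p} {}"
| pair: "(p, q) \<in> all_constr W \<Longrightarrow> 2 \<le> K \<Longrightarrow> splits W K {p, q} {}"
| cut: "e \<in> E \<Longrightarrow> E \<subseteq> succ W \<inter> C \<times> C \<Longrightarrow> splits W K C (E - {e}) \<Longrightarrow> splits W K C E"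
| union: "C1 \<inter> C2 = {} \<Longrightarrow> all_constr W \<inter> (C1 \<times> C2 \<union> C2 \<times> C1) = {} \<Longrightarrow>
    splits W K C1 E1 \<Longrightarrow> splits W K C2 E2 \<Longrightarrow> card (heads (C1 \<union> C2) (E1 \<union> E2)) \<le> K \<Longrightarrow>
    splits W K (C1 \<union> C2) (E1 \<union> E2)"

section \<open>From derivations to split-trees\<close>

lemma finite_labels [simp]: "finite (labels t)"
  by (induction t) auto

lemma root_in_labels: "root t \<in> labels t"
  by (cases t) auto

lemma tree_width_le_iff: "tree_width t \<le> K \<longleftrightarrow> (\<forall>L\<in>labels t. width L \<le> K)"
proof -
  have "width ` labels t \<noteq> {}" using root_in_labels by blast
  then show ?thesis unfolding tree_width_def by simp
qed

locale ranked_tcw =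
  fixes \<Sigma> :: "'a set" and \<I> :: "real set set" and W :: "('v, 'a) tcw" and r :: "'v \<Rightarrow> nat"
  assumes tcw: "is_tcw \<Sigma> \<I> W" and simple: "simple_tcw W"
    and bij_rank: "bij_betw r (verts W) {..<card (verts W)}" and le_rank: "le W = rank_order r (verts W)"
begin

lemma inj_rank: "inj_on r (verts W)"
  using bij_rank by (rule bij_betw_imp_inj_on)

lemma finite_verts: "finite (verts W)"
  using tcw by (simp add: is_tcw_def)

lemma lt_rank: "lt W = {(u, v). u \<in> verts W \<and> v \<in> verts W \<and> r u < r v}"
  unfolding lt_def le_rank rank_order_def
  by (auto simp: le_less inj_on_eq_iff[OF inj_rank])

lemma constr_lt: "constr W I \<subseteq> lt W"
  using tcw unfolding is_tcw_def by (cases "I \<in> \<I>") auto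

lemma all_constr_lt: "all_constr W \<subseteq> lt W"
  unfolding all_constr_def using constr_lt by blast

lemma succ_direct: "succ W = direct_succ (rank_order r (verts W))"
  using tcw le_rank unfolding is_tcw_def by simp

lemma succ_rank: "(u, v) \<in> succ W \<Longrightarrow> u \<in> verts W \<and> v \<in> verts W \<and> r u < r v"
  unfolding succ_direct by (simp add: direct_succ_rank_order[OF inj_rank])

lemma le_Int: "D \<subseteq> verts W \<Longrightarrow> le W \<inter> D \<times> D = rank_order r D"
  unfolding le_rank by (rule rank_order_Int)

lemma succ_Int: "D \<subseteq> verts W \<Longrightarrow> succ W \<inter> D \<times> D \<subseteq> direct_succ (le W \<inter> D \<times> D)"
  unfolding succ_direct le_rank direct_succ_def by blast

lemma le_state:
  assumes "D \<subseteq> verts W"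
  shows "le (state W D E) = le W \<inter> D \<times> D"
  unfolding le_def[of "state W D E"] state_simps le_Int[OF assms]
  by (rule rtrancl_direct_succ_rank_order[OF inj_on_subset[OF inj_rank assms]])

lemma edge_state:
  assumes "D \<subseteq> verts W" "E \<subseteq> succ W \<inter> D \<times> D"
  shows "edge (state W D E) = E"
  unfolding edge_def using succ_Int[OF assms(1)] assms(2) by auto

lemma is_split_tcw_state:
  assumes D: "D \<subseteq> verts W" "D \<noteq> {}"
  shows "is_split_tcw \<Sigma> \<I> (state W D E)"
proof -
  have "constr W I \<inter> D \<times> D \<subseteq> lt (state W D E)" for I
    using constr_lt[of I] unfolding lt_def le_state[OF D(1)] by auto
  moreover have "linear_order_on D (le (state W D E))"
    unfolding le_state[OF D(1)] le_Int[OF D(1)]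
    by (rule linear_order_rank_order[OF inj_on_subset[OF inj_rank D(1)]])
  moreover have "finite D" using D finite_verts finite_subset by blast
  moreover have "\<forall>v\<in>D. lab W v \<in> insert None (Some ` \<Sigma>)" "\<forall>I. I \<notin> \<I> \<longrightarrow> constr W I = {}"
    using tcw D unfolding is_tcw_def by blast+
  ultimately show ?thesis
    unfolding is_split_tcw_def is_tcw_def state_simps le_state[OF D(1)] using D(2) by auto
qed

lemma width_state_le:
  assumes D: "D \<subseteq> verts W" and E: "E \<subseteq> succ W \<inter> D \<times> D"
  shows "width (state W D E) \<le> card (heads D E)"
  unfolding width_def blocks_def edge_state[OF assms] state_simps
  using assms finite_verts succ_rank
  by (intro card_components_le_heads[where r = r]) (auto intro: finite_subset)

lemma split_components_state:
  assumes "D \<subseteq> verts W" "E \<subseteq> succ W \<inter> D \<times> D"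
  shows "split_components (state W D E) = components D (E \<union> all_constr W \<inter> D \<times> D)"
  unfolding split_components_def edge_state[OF assms] by simp

lemma induced_state:
  assumes "D1 \<subseteq> D" "D \<subseteq> verts W" "E \<subseteq> succ W \<inter> D \<times> D"
  shows "induced (state W D E) D1 = state W D1 (E \<inter> D1 \<times> D1)"
proof -
  have "direct_succ (le W \<inter> D1 \<times> D1) \<subseteq> D1 \<times> D1"
    unfolding direct_succ_def by auto
  moreover have "le W \<inter> D \<times> D \<inter> D1 \<times> D1 = le W \<inter> D1 \<times> D1"
    "constr W I \<inter> D \<times> D \<inter> D1 \<times> D1 = constr W I \<inter> D1 \<times> D1" for I
    using assms(1) by auto
  ultimately show ?thesis
    unfolding induced_def edge_state[OF assms(2,3)] le_state[OF assms(2)]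
    by (auto simp: state_def)
qed

definition has_tree :: "nat \<Rightarrow> 'v set \<Rightarrow> ('v \<times> 'v) set \<Rightarrow> bool" where
  "has_tree K D E \<longleftrightarrow>
     (\<exists>t. is_split_tree_for \<Sigma> \<I> (state W D E) t \<and> tree_width t \<le> K)"

context
  fixes K :: nat and D :: "'v set" and E :: "('v \<times> 'v) set"
  assumes D: "D \<subseteq> verts W" "D \<noteq> {}" and E: "E \<subseteq> succ W \<inter> D \<times> D"
    and K: "card (heads D E) \<le> K"
begin

lemma width_K: "width (state W D E) \<le> K"
  using width_state_le[OF D(1) E] K by simp

lemma has_tree_atomic:
  assumes "atomic (state W D E)"
  shows "has_tree K D E"
  unfolding has_tree_def is_split_tree_for_def tree_width_le_iff
  using assms is_split_tcw_state[OF D] width_K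
  by (intro exI[of _ "Leaf (state W D E)"]) auto

lemma has_tree_cut:
  assumes conn: "\<And>D'. D' \<subseteq> D \<Longrightarrow> closed_in (E \<union> all_constr W \<inter> D \<times> D) D' \<Longrightarrow>
        closed_in (E \<union> all_constr W \<inter> D \<times> D) (D - D') \<Longrightarrow> D' = {} \<or> D' = D"
    and "e \<in> E" and "has_tree K D (E - {e})"
  shows "has_tree K D E"
proof -
  obtain t where t: "is_split_tree_for \<Sigma> \<I> (state W D (E - {e})) t" "tree_width t \<le> K"
    using assms(3) unfolding has_tree_def by blast
  have "split_connected (state W D E)"
    unfolding split_connected_def split_components_state[OF D(1) E]
    using E by (intro card_components_eq_1 D(2) conn) auto
  moreover have "e \<in> direct_succ (le W \<inter> D \<times> D)"
    using succ_Int[OF D(1)] E \<open>e \<in> E\<close> by blast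
  then have "cut (state W D E) (state W D (E - {e}))"
    unfolding cut_def edge_state[OF D(1) E] using \<open>e \<in> E\<close>
    by (intro bexI[of _ e]) (auto simp: state_def)
  ultimately show ?thesis
    unfolding has_tree_def
    using t is_split_tcw_state[OF D] width_K
    by (intro exI[of _ "Unary (state W D E) t"]) (auto simp: is_split_tree_for_def tree_width_le_iff)
qed

lemma has_tree_union:
  assumes part: "D = D1 \<union> D2" "D1 \<inter> D2 = {}" "D1 \<noteq> {}" "D2 \<noteq> {}"
    and cl: "closed_in (E \<union> all_constr W \<inter> D \<times> D) D1" "closed_in (E \<union> all_constr W \<inter> D \<times> D) D2"
    and trees: "has_tree K D1 (E \<inter> D1 \<times> D1)" "has_tree K D2 (E \<inter> D2 \<times> D2)"
  shows "has_tree K D E"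
proof -
  let ?S = "state W D E" and ?R = "E \<union> all_constr W \<inter> D \<times> D"
  let ?C1 = "{c \<in> components D ?R. c \<subseteq> D1}" and ?C2 = "{c \<in> components D ?R. c \<subseteq> D2}"
  obtain t1 t2 where
    t1: "is_split_tree_for \<Sigma> \<I> (state W D1 (E \<inter> D1 \<times> D1)) t1" "tree_width t1 \<le> K" and
    t2: "is_split_tree_for \<Sigma> \<I> (state W D2 (E \<inter> D2 \<times> D2)) t2" "tree_width t2 \<le> K"
    using trees unfolding has_tree_def by blast
  have U: "\<Union> ?C1 = D1" "\<Union> ?C2 = D2" and C: "components D ?R = ?C1 \<union> ?C2"
    using components_closed_partition[OF part(1) cl]
      components_closed_partition[of D D2 D1, OF _ cl(2,1)] part(1) by (simp_all add: Un_commute)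
  have disj: "?C1 \<inter> ?C2 = {}"
  proof -
    have "c = {}" if "c \<subseteq> D1" "c \<subseteq> D2" for c using part(2) that by blast
    then show ?thesis using empty_notin_components[of D ?R] by auto
  qed
  have ne: "?C1 \<noteq> {}" "?C2 \<noteq> {}" using U part(3,4) by (metis Union_empty)+
  have "is_disjoint_union ?S (root t1) (root t2)"
    unfolding is_disjoint_union_def split_components_state[OF D(1) E]
  proof (intro exI conjI)
    show "root t1 = induced ?S (\<Union> ?C1)" "root t2 = induced ?S (\<Union> ?C2)"
      using t1 t2 part(1) induced_state[OF _ D(1) E, of D1] induced_state[OF _ D(1) E, of D2]
      unfolding U is_split_tree_for_def by (metis Un_upper1 Un_upper2)+
  qed (use ne disj C in auto)
  moreover have "\<not> split_connected ?S"
    unfolding split_connected_def split_components_state[OF D(1) E]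
    using C ne disj by (auto simp: card_1_singleton_iff)
  ultimately show ?thesis
    unfolding has_tree_def
    using t1 t2 is_split_tcw_state[OF D] width_K
    by (intro exI[of _ "Binary ?S t1 t2"]) (auto simp: is_split_tree_for_def tree_width_le_iff)
qed

end

section \<open>Following a derivation on unions of components\<close>

lemma splits_wf:
  assumes "splits W K C E"
  shows "C \<subseteq> verts W \<and> E \<subseteq> succ W \<inter> C \<times> C \<and> card (heads C E) \<le> K"
  using assms
proof induction
  case (pair p q)
  then show ?case using all_constr_lt card_insert_le_m1[of 2 "{q}" p]
    by (auto simp: heads_def lt_rank)
next
  \<comment> \<open>Restoring the edge \<open>e\<close> can only remove a head, so
    \<open>cut\<close> needs no width condition of its own.\<close>
  case (cut e E C)
  then have "finite (heads C (E - {e}))" using finite_verts finite_subset by (auto simp: heads_def)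
  then have "card (heads C E) \<le> card (heads C (E - {e}))"
    by (rule card_mono) (auto simp: heads_def)
  with cut show ?case by simp
qed (auto simp: heads_def)

text \<open>An edge into a point of \<open>D\<close> starts in \<open>D\<close> by closedness, so
  restricting the edges to \<open>D\<close> creates no new head.\<close>

lemma card_heads_closed:
  assumes "D \<subseteq> C" "C \<subseteq> verts W" "closed_in E D"
  shows "card (heads D (E \<inter> D \<times> D)) \<le> card (heads C E)"
proof (rule card_mono)
  show "finite (heads C E)"
    using assms(2) finite_verts unfolding heads_def by (auto intro: finite_subset)
  show "heads D (E \<inter> D \<times> D) \<subseteq> heads C E"
    using assms(1,3) unfolding heads_def closed_in_def by (auto simp: image_iff)
qed

lemma atomic_point: "p \<in> verts W \<Longrightarrow> atomic (state W {p} {})"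
  unfolding atomic_def using all_constr_lt by (auto simp: direct_succ_def lt_rank)

lemma atomic_pair:
  assumes "(p, q) \<in> all_constr W"
  shows "atomic (state W {p, q} {})"
proof -
  obtain I where I: "(p, q) \<in> constr W I" using assms by (auto simp: all_constr_def)
  have lt: "p \<in> verts W" "q \<in> verts W" "r p < r q" using constr_lt[of I] I by (auto simp: lt_rank)
  have "succ (state W {p, q} {}) = {(p, q)}"
  proof -
    have inj: "inj_on r {p, q}" and sub: "{p, q} \<subseteq> verts W" using lt by auto
    have "(u, v) \<in> direct_succ (rank_order r {p, q}) \<longleftrightarrow> (u, v) = (p, q)" for u v
      unfolding direct_succ_rank_order[OF inj] using lt by auto
    then show ?thesis unfolding state_simps le_Int[OF sub] by auto
  qed
  moreover have "constr W I \<inter> {p, q} \<times> {p, q} = {(p, q)}"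
    using I lt constr_lt[of I] by (auto simp: lt_rank)
  \<comment> \<open>Another interval on \<open>(p, q)\<close> would be a second constraint with the
    same endpoints, against simplicity; all other pairs are excluded by the order.\<close>
  moreover have "constr W J \<inter> {p, q} \<times> {p, q} = {}" if "J \<noteq> I" for J
  proof -
    have "(u, v) \<notin> constr W J" if "u \<in> {p, q}" "v \<in> {p, q}" for u v
    proof
      assume a: "(u, v) \<in> constr W J"
      then have "u = p \<and> v = q" using that lt constr_lt[of J] by (auto simp: lt_rank)
      then show False using a I \<open>J \<noteq> I\<close> simple lt unfolding simple_tcw_def by blast
    qed
    then show ?thesis by auto
  qed
  ultimately show ?thesis
    unfolding atomic_def using lt by (intro disjI2 exI[of _ p] exI[of _ q] exI[of _ I]) auto
qed

text \<open>The derivation is followed on every union of components separately, which makes a cut of a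
  disconnected structure a cut of one part.\<close>

lemma has_tree_closed:
  assumes "splits W K C E" "D \<subseteq> C" "D \<noteq> {}" "closed_in (E \<union> all_constr W \<inter> C \<times> C) D"
  shows "has_tree K D (E \<inter> D \<times> D)"
  using assms
proof (induction arbitrary: D rule: splits.induct)
  case (point p)
  then have "D = {p}" by auto
  moreover have "has_tree K {p} {}"
    using point(1,2) by (intro has_tree_atomic atomic_point) (auto simp: heads_def)
  ultimately show ?case by simp
next
  case (pair p q)
  then have "D = {p, q}" by (auto simp: closed_in_def)
  moreover have "splits W K {p, q} {}" using pair(1,2) by (rule splits.pair)
  from splits_wf[OF this] have "has_tree K {p, q} {}"
    by (intro has_tree_atomic atomic_pair[OF pair(1)]) auto
  ultimately show ?case by simp
next
  case (cut e E C)
  have "splits W K C E" using cut.hyps by (rule splits.cut)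
  then have wf: "C \<subseteq> verts W" "E \<subseteq> succ W \<inter> C \<times> C" "card (heads C E) \<le> K"
    using splits_wf by blast+
  let ?R = "E \<union> all_constr W \<inter> C \<times> C"
  \<comment> \<open>Before the cut is made, \<open>D\<close> is divided into proper closed parts as
    long as there are any. The inner induction on its size ends at connected sets, where a unary
    node is legitimate.\<close>
  show ?case using cut.prems
  proof (induction "card D" arbitrary: D rule: less_induct)
    case less
    let ?RD = "E \<inter> D \<times> D \<union> all_constr W \<inter> D \<times> D"
    have "finite D" using less.prems wf finite_verts by (meson finite_subset)
    have "closed_in E D" using less.prems(3) by (auto simp: closed_in_def)
    have facts: "D \<subseteq> verts W" "D \<noteq> {}" "E \<inter> D \<times> D \<subseteq> succ W \<inter> D \<times> D"
      "card (heads D (E \<inter> D \<times> D)) \<le> K"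
      using less.prems wf card_heads_closed[OF less.prems(1) wf(1) \<open>closed_in E D\<close>] by auto
    show ?case
    proof (cases "\<exists>D1\<subseteq>D. closed_in ?RD D1 \<and> closed_in ?RD (D - D1) \<and> D1 \<noteq> {} \<and> D1 \<noteq> D")
      case True
      then obtain D1 where D1: "D1 \<subseteq> D" "closed_in ?RD D1" "closed_in ?RD (D - D1)"
        "D1 \<noteq> {}" "D1 \<noteq> D" by blast
      have sub: "has_tree K D' (E \<inter> D' \<times> D')"
        if "D' \<subset> D" "D' \<noteq> {}" "closed_in ?RD D'" for D'
      proof (rule less.hyps)
        show "card D' < card D" using that \<open>finite D\<close> by (simp add: psubset_card_mono)
        have "?R \<inter> D \<times> D = ?RD" using less.prems(1) by auto
        then show "closed_in ?R D'"
          using closed_in_trans[OF less.prems(3)] that(1,3) by auto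
      qed (use that less.prems in auto)
      have restr: "E \<inter> D \<times> D \<inter> D' \<times> D' = E \<inter> D' \<times> D'" if "D' \<subseteq> D" for D' using that by auto
      have "has_tree K D1 (E \<inter> D \<times> D \<inter> D1 \<times> D1)"
        unfolding restr[OF D1(1)] using D1 by (intro sub) auto
      moreover have "has_tree K (D - D1) (E \<inter> D \<times> D \<inter> (D - D1) \<times> (D - D1))"
        unfolding restr[OF Diff_subset] using D1 by (intro sub) auto
      ultimately show ?thesis
        using D1 by (intro has_tree_union[OF facts, of D1 "D - D1"]) auto
    next
      case False
      have "closed_in (E - {e} \<union> all_constr W \<inter> C \<times> C) D"
        using less.prems(3) by (auto simp: closed_in_def)
      moreover have "(E - {e}) \<inter> D \<times> D = E \<inter> D \<times> D - {e}" by blast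
      ultimately have tree: "has_tree K D (E \<inter> D \<times> D - {e})"
        using cut.IH[OF less.prems(1,2)] by simp
      \<comment> \<open>An edge outside \<open>D\<close> does not affect this part, and the node is
        skipped.\<close>
      show ?thesis
      proof (cases "e \<in> D \<times> D")
        case True
        show ?thesis
          using False True cut.hyps(1) tree by (intro has_tree_cut[OF facts, of e]) blast+
      qed (use tree in auto)
    qed
  qed
next
  case (union C1 C2 E1 E2)
  have "splits W K (C1 \<union> C2) (E1 \<union> E2)" using union.hyps by (rule splits.union)
  then have wf: "C1 \<union> C2 \<subseteq> verts W" "E1 \<union> E2 \<subseteq> succ W \<inter> (C1 \<union> C2) \<times> (C1 \<union> C2)"
    "card (heads (C1 \<union> C2) (E1 \<union> E2)) \<le> K"
    using splits_wf by blast+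
  have E: "E1 \<subseteq> C1 \<times> C1" "E2 \<subseteq> C2 \<times> C2" using splits_wf union.hyps by blast+
  let ?E = "(E1 \<union> E2) \<inter> D \<times> D"
  have "closed_in (E1 \<union> E2) D" using union.prems(3) by (auto simp: closed_in_def)
  from card_heads_closed[OF union.prems(1) wf(1) this] wf(3)
  have "card (heads D ?E) \<le> K" by linarith
  with wf union.prems(1,2)
  have facts: "D \<subseteq> verts W" "D \<noteq> {}" "?E \<subseteq> succ W \<inter> D \<times> D" "card (heads D ?E) \<le> K"
    by auto
  have restr: "(E1 \<union> E2) \<inter> (D \<inter> C1) \<times> (D \<inter> C1) = E1 \<inter> (D \<inter> C1) \<times> (D \<inter> C1)"
    "(E1 \<union> E2) \<inter> (D \<inter> C2) \<times> (D \<inter> C2) = E2 \<inter> (D \<inter> C2) \<times> (D \<inter> C2)"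
    using E union.hyps(1) by auto
  have tree1: "has_tree K (D \<inter> C1) ((E1 \<union> E2) \<inter> (D \<inter> C1) \<times> (D \<inter> C1))" if "D \<inter> C1 \<noteq> {}"
    unfolding restr using that E union.prems by (intro union.IH) (auto simp: closed_in_def)
  have tree2: "has_tree K (D \<inter> C2) ((E1 \<union> E2) \<inter> (D \<inter> C2) \<times> (D \<inter> C2))" if "D \<inter> C2 \<noteq> {}"
    unfolding restr using that E union.prems by (intro union.IH) (auto simp: closed_in_def)
  \<comment> \<open>If \<open>D\<close> lies within one side, the binary node is skipped; otherwise
    neither edges nor constraints join its two intersections with \<open>C1\<close> and
    \<open>C2\<close>.\<close>
  consider "D \<inter> C1 = {}" | "D \<inter> C2 = {}" | "D \<inter> C1 \<noteq> {}" "D \<inter> C2 \<noteq> {}" by blast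
  then show ?case
  proof cases
    case 1
    then have "D \<inter> C2 = D" using union.prems by auto
    with tree2 union.prems show ?thesis by simp
  next
    case 2
    then have "D \<inter> C1 = D" using union.prems by auto
    with tree1 union.prems show ?thesis by simp
  next
    case 3
    have r': "?E \<inter> (D \<inter> C') \<times> (D \<inter> C') = (E1 \<union> E2) \<inter> (D \<inter> C') \<times> (D \<inter> C')" for C' by auto
    show ?thesis
    proof (rule has_tree_union[OF facts, of "D \<inter> C1" "D \<inter> C2"])
      have "u \<in> C1 \<longleftrightarrow> v \<in> C1" "u \<in> C2 \<longleftrightarrow> v \<in> C2"
        if "(u, v) \<in> ?E \<union> all_constr W \<inter> D \<times> D" for u v
        using that E union.hyps(1,2) union.prems(1) by blast+
      then show "closed_in (?E \<union> all_constr W \<inter> D \<times> D) (D \<inter> C1)"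
        "closed_in (?E \<union> all_constr W \<inter> D \<times> D) (D \<inter> C2)"
        unfolding closed_in_def by auto
    qed (use 3 union.prems union.hyps(1) tree1 tree2 in \<open>auto simp: r'\<close>)
  qed
qed

lemma split_width_le:
  assumes "splits W K (verts W) (succ W)"
  shows "split_width \<Sigma> \<I> (split_of_tcw W) \<le> enat K"
proof -
  have sub: "le W \<inter> verts W \<times> verts W = le W" "constr W I \<inter> verts W \<times> verts W = constr W I" for I
    using constr_lt[of I] by (auto simp: le_def lt_def)
  have succ: "direct_succ (le W) = succ W" using succ_direct le_rank by simp
  have "state W (verts W) (succ W) = split_of_tcw W"
    by (simp add: state_def split_of_tcw_def sub succ)
  moreover have "succ W \<inter> verts W \<times> verts W = succ W" using succ_rank by auto
  moreover have "verts W \<noteq> {}" using tcw by (simp add: is_tcw_def)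
  moreover have "closed_in (succ W \<union> all_constr W \<inter> verts W \<times> verts W) (verts W)"
    using succ_rank by (auto simp: closed_in_def)
  ultimately have "has_tree K (verts W) (succ W)"
    using has_tree_closed[OF assms, of "verts W"] by simp
  then obtain t where "is_split_tree_for \<Sigma> \<I> (split_of_tcw W) t" "tree_width t \<le> K"
    unfolding has_tree_def \<open>state W (verts W) (succ W) = _\<close> by blast
  then show ?thesis
    unfolding split_width_def by (intro INF_lower2[of t]) auto
qed

end

section \<open>Clock constraints and holes\<close>

text \<open>First positions of the maximal runs of consecutive numbers, so the cardinality counts
  intervals. The case \<open>p = 0\<close> is separate because \<open>0 - 1\<close> is
  \<open>0\<close>.\<close>

definition starts :: "nat set \<Rightarrow> nat set" where
  "starts C = {p \<in> C. p = 0 \<or> p - 1 \<notin> C}"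

lemma starts_subset: "starts C \<subseteq> C"
  by (auto simp: starts_def)

lemma finite_starts: "finite C \<Longrightarrow> finite (starts C)"
  using starts_subset finite_subset by blast

lemma starts_Un: "starts (A \<union> B) \<subseteq> starts A \<union> starts B"
  by (auto simp: starts_def)

lemma ex_start_below:
  assumes "q \<in> J"
  obtains a where "a \<in> starts J" "a \<le> q" "{a..q} \<subseteq> J"
proof -
  have "\<exists>a\<in>starts J. a \<le> q \<and> {a..q} \<subseteq> J"
    using assms
  proof (induction q)
    case 0
    then show ?case by (intro bexI[of _ 0]) (auto simp: starts_def)
  next
    case (Suc q)
    show ?case
    proof (cases "q \<in> J")
      case True
      with Suc obtain a where "a \<in> starts J" "a \<le> q" "{a..q} \<subseteq> J" by blast
      with Suc.prems show ?thesis by (intro bexI[of _ a]) (auto simp: le_Suc_eq)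
    next
      case False
      with Suc.prems show ?thesis by (intro bexI[of _ "Suc q"]) (auto simp: starts_def)
    qed
  qed
  with that show ?thesis by blast
qed

lemma starts_remove_max:
  assumes "\<And>p. p \<in> J \<Longrightarrow> p \<le> j"
  shows "starts (J - {j}) \<subseteq> starts J"
  unfolding starts_def using assms by (auto, fastforce)

text \<open>Above \<open>i\<close>, only \<open>Suc i\<close> can be a new start. In the second
  bound it is paid for by the start of the run containing \<open>i\<close>, which is not above
  \<open>i\<close>; in the sum that start may survive below \<open>i\<close>, whence the additional
  one.\<close>

lemma card_starts_split:
  fixes i j :: nat
  assumes "finite J" "i \<in> J"
  shows "card (starts (J \<inter> {..<i})) \<le> card (starts J)"
    and "card (starts (J \<inter> {i<..<j})) \<le> card (starts J)"
    and "card (starts (J \<inter> {..<i})) + card (starts (J \<inter> {i<..<j})) \<le> card (starts J) + 1"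
proof -
  let ?lo = "starts J \<inter> {..<i}" and ?hi = "starts J \<inter> {i<..}"
  have fin: "finite (starts J)" using assms(1) by (rule finite_starts)
  have lo: "starts (J \<inter> {..<i}) \<subseteq> ?lo" by (auto simp: starts_def)
  have hi: "starts (J \<inter> {i<..<j}) \<subseteq> insert (Suc i) ?hi" by (auto simp: starts_def)
  have lo': "card (starts (J \<inter> {..<i})) \<le> card ?lo" using fin lo by (simp add: card_mono)
  have "card (starts (J \<inter> {i<..<j})) \<le> card (insert (Suc i) ?hi)" using fin hi by (simp add: card_mono)
  also have "\<dots> \<le> card ?hi + 1" using fin by (simp add: card_insert_if)
  finally have hi': "card (starts (J \<inter> {i<..<j})) \<le> card ?hi + 1" .
  obtain a where a: "a \<in> starts J" "a \<le> i" using ex_start_below[OF assms(2)] by blast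
  then have "a \<notin> ?hi" by simp
  with a(1) have "?hi \<subset> starts J" by blast
  then have "card ?hi < card (starts J)" using fin psubset_card_mono by blast
  with hi' show "card (starts (J \<inter> {i<..<j})) \<le> card (starts J)" by linarith
  have "card ?lo + card ?hi = card (?lo \<union> ?hi)" using fin by (intro card_Un_disjoint[symmetric]) auto
  also have "\<dots> \<le> card (starts J)" using fin by (intro card_mono) auto
  finally show "card (starts (J \<inter> {..<i})) + card (starts (J \<inter> {i<..<j})) \<le> card (starts J) + 1"
    using lo' hi' by linarith
  show "card (starts (J \<inter> {..<i})) \<le> card (starts J)"
    using lo' card_mono[OF fin, of ?lo] by auto
qed

text \<open>Any choice of related tags is an injection into \<open>T\<close>. Tags need not be
  functions of the elements, which lets them record a reason why a run begins.\<close>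

lemma card_le_card_tags:
  fixes S :: "'b :: linorder set"
  assumes "finite T" and ex: "\<And>p. p \<in> S \<Longrightarrow> \<exists>c\<in>T. P p c"
    and uniq: "\<And>p p' c. p \<in> S \<Longrightarrow> p' \<in> S \<Longrightarrow> p < p' \<Longrightarrow> P p c \<Longrightarrow> P p' c \<Longrightarrow> False"
  shows "card S \<le> card T"
proof -
  obtain f where f: "\<And>p. p \<in> S \<Longrightarrow> f p \<in> T \<and> P p (f p)" using ex by metis
  have "inj_on f S"
  proof (rule inj_onI)
    fix p p' assume "p \<in> S" "p' \<in> S" "f p = f p'"
    then show "p = p'" using uniq[of p p' "f p"] uniq[of p' p "f p"] f[of p] f[of p']
      by (cases p p' rule: linorder_cases) auto
  qed
  then show ?thesis using f assms(1) by (intro card_inj_on_le[of f]) auto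
qed

text \<open>\<open>stk\<close> collects the constraints of all stacks, and positions of phase \<open>c\<close> carry stack \<open>c mod n\<close>.\<close>

locale round_positions =
  fixes N k n :: nat and Y :: "'c set"
    and stk :: "(nat \<times> nat) set" and clk :: "'c \<Rightarrow> (nat \<times> nat) set" and phase :: "nat \<Rightarrow> nat"
  assumes Y: "finite Y" "Y \<noteq> {}" and k: "0 < k" and n: "0 < n"
    and lt: "(i, j) \<in> stk \<union> (\<Union>x\<in>Y. clk x) \<Longrightarrow> i < j \<and> j < N"
    and simple: "(i, j) \<in> stk \<union> (\<Union>x\<in>Y. clk x) \<Longrightarrow> (i', j') \<in> stk \<union> (\<Union>x\<in>Y. clk x) \<Longrightarrow>
      {i, j} \<inter> {i', j'} \<noteq> {} \<Longrightarrow> i = i' \<and> j = j'"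
    and stk_clk: "x \<in> Y \<Longrightarrow> stk \<inter> clk x = {}"
    and stk_phase: "(i, j) \<in> stk \<Longrightarrow> phase i mod n = phase j mod n"
    and stk_nested: "(i, j) \<in> stk \<Longrightarrow> (i', j') \<in> stk \<Longrightarrow> phase i mod n = phase i' mod n \<Longrightarrow>
      i < i' \<Longrightarrow> i' < j \<Longrightarrow> j' < j"
    and clk_block: "x \<in> Y \<Longrightarrow> (i, j) \<in> clk x \<Longrightarrow> (i', j') \<in> clk x \<Longrightarrow> i \<le> m \<Longrightarrow> m \<le> i' \<Longrightarrow> i' \<le> j \<Longrightarrow>
      \<exists>l. (m, l) \<in> clk x \<and> j' \<le> l \<and> l \<le> j"
    and phase_mono: "p \<le> q \<Longrightarrow> q < N \<Longrightarrow> phase p \<le> phase q"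
    and phase_less: "p < N \<Longrightarrow> phase p < k * n"
begin

section \<open>Targets and claimed sets\<close>

abbreviation constrs :: "(nat \<times> nat) set" where
  "constrs \<equiv> stk \<union> (\<Union>x\<in>Y. clk x)"

definition target :: "nat \<Rightarrow> nat" where
  "target p = (if \<exists>j. \<exists>x\<in>Y. (p, j) \<in> clk x then THE j. \<exists>x\<in>Y. (p, j) \<in> clk x else p)"

lemma target_eq: "x \<in> Y \<Longrightarrow> (p, j) \<in> clk x \<Longrightarrow> target p = j"
proof -
  assume *: "x \<in> Y" "(p, j) \<in> clk x"
  have "(THE j. \<exists>x\<in>Y. (p, j) \<in> clk x) = j"
    using * simple[of p j p] by (intro the_equality) blast+
  with * show ?thesis unfolding target_def by auto
qed

lemma target_cases:
  obtains "target p = p" | x where "x \<in> Y" "(p, target p) \<in> clk x" "p < target p"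
proof (cases "\<exists>j. \<exists>x\<in>Y. (p, j) \<in> clk x")
  case True
  then obtain x j where x: "x \<in> Y" "(p, j) \<in> clk x" by blast
  then show ?thesis using that(2)[of x] target_eq[OF x] lt[of p j] by auto
next
  case False
  then have "target p = p" unfolding target_def by simp
  then show ?thesis by (rule that(1))
qed

lemma target_ge: "p \<le> target p"
  by (rule target_cases[of p]) auto

lemma target_less_iff: "target p < N \<longleftrightarrow> p < N"
proof (rule target_cases[of p])
  fix x assume "x \<in> Y" "(p, target p) \<in> clk x" "p < target p"
  then show ?thesis using lt[of p "target p"] by auto
qed simp

lemma target_stk: "(i, j) \<in> stk \<Longrightarrow> target i = i \<and> target j = j"
proof -
  assume ij: "(i, j) \<in> stk"
  have "target p = p" if p: "p \<in> {i, j}" for p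
  proof (rule target_cases[of p])
    fix x assume x: "x \<in> Y" "(p, target p) \<in> clk x"
    \<comment> \<open>Positions carry no intervals, so \<open>simple\<close> only yields equal pairs
      here; \<open>stk_clk\<close> excludes a pair in both a stack and a clock relation.\<close>
    then have "i = p \<and> j = target p" using simple[of i j p "target p"] ij p by auto
    then have False using stk_clk[OF x(1)] x ij by auto
    then show ?thesis ..
  qed
  then show ?thesis by auto
qed

text \<open>A clock target cannot be a clock source as well, by simplicity. Hence both ends of a
  clock constraint have the same \<open>target\<close> and are claimed together.\<close>

lemma target_target: "target (target p) = target p"
proof (rule target_cases[of p])
  fix x assume x: "x \<in> Y" "(p, target p) \<in> clk x" "p < target p"
  show ?thesis
  proof (rule target_cases[of "target p"])
    fix y assume y: "y \<in> Y" "(target p, target (target p)) \<in> clk y"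
    have "p = target p"
      using simple[of p "target p" "target p" "target (target p)"] x y by auto
    with x show ?thesis by simp
  qed
qed simp

text \<open>This is \<open>clk_block\<close> in terms of \<open>target\<close>: a source not beyond
  the target of an earlier one shares its reset block, so the positions between are sources too, and
  within a block later sources have earlier targets.\<close>

lemma target_block:
  assumes "x \<in> Y" "(p, target p) \<in> clk x" "(p', target p') \<in> clk x" "p \<le> m" "m \<le> p'" "p' \<le> target p"
  shows "(m, target m) \<in> clk x" "target p' \<le> target m" "target m \<le> target p"
  using clk_block[OF assms] target_eq[OF assms(1), of m] by auto

definition claim :: "nat set \<Rightarrow> nat set" where
  "claim J = {p. target p \<in> J}"

text \<open>Within an interval of \<open>J\<close>, the sources claimed from the left of it and the sources given away
  beyond it form, for each clock, a contiguous part of one reset block each. The tags name these parts.\<close>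

lemma card_starts_claim:
  assumes "finite J"
  shows "card (starts (claim J)) \<le> card (starts J) * (2 * card Y + 1)"
proof -
  \<comment> \<open>A tag has the start \<open>a\<close> of the interval of \<open>J\<close> that
    contains \<open>target p\<close>. It is completed by \<open>None\<close> if
    \<open>p = a\<close>, by \<open>(x, True)\<close> if \<open>p < a\<close> is a source of
    \<open>x\<close>, and by \<open>(x, False)\<close> if \<open>a < p\<close> and
    \<open>p - 1\<close> is a source of \<open>x\<close> with target outside \<open>J\<close>:
    \<open>1 + 2 * card Y\<close> tags for each interval.\<close>
  let ?T = "starts J \<times> ({None} \<union> Some ` (Y \<times> (UNIV :: bool set)))"
  define P where "P p c = (case c of (a, None) \<Rightarrow> p = a
     | (a, Some (x, True)) \<Rightarrow> p < a \<and> a \<le> target p \<and> {a..target p} \<subseteq> J \<and> x \<in> Y \<and> (p, target p) \<in> clk x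
     | (a, Some (x, False)) \<Rightarrow> a < p \<and> {a..target p} \<subseteq> J \<and> x \<in> Y \<and> (p - 1, target (p - 1)) \<in> clk x)"
    for p and c :: "nat \<times> ('c \<times> bool) option"
  have fin: "finite (starts J)" using assms by (simp add: finite_starts)
  have "card (starts (claim J)) \<le> card ?T"
  proof (rule card_le_card_tags[where P = P])
    fix p assume p: "p \<in> starts (claim J)"
    then have "target p \<in> J" by (auto simp: starts_def claim_def)
    then obtain a where a: "a \<in> starts J" "a \<le> target p" "{a..target p} \<subseteq> J"
      by (rule ex_start_below)
    consider "p < a" | "p = a" | "a < p" by linarith
    then show "\<exists>c\<in>?T. P p c"
    proof cases
      case 1
      with a obtain x where "x \<in> Y" "(p, target p) \<in> clk x"
        using target_cases[of p] by (metis not_le)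
      with 1 a show ?thesis by (intro bexI[of _ "(a, Some (x, True))"]) (auto simp: P_def)
    next
      case 2
      with a show ?thesis by (intro bexI[of _ "(a, None)"]) (auto simp: P_def)
    next
      case 3
      then have "target (p - 1) \<notin> J" using p by (auto simp: starts_def claim_def)
      moreover have "p - 1 \<in> {a..target p}" using 3 target_ge[of p] by auto
      then have "p - 1 \<in> J" using a(3) by blast
      ultimately obtain x where "x \<in> Y" "(p - 1, target (p - 1)) \<in> clk x"
        using target_cases[of "p - 1"] by metis
      with 3 a show ?thesis by (intro bexI[of _ "(a, Some (x, False))"]) (auto simp: P_def)
    qed
  next
    fix p p' c assume p: "p \<in> starts (claim J)" "p' \<in> starts (claim J)" "p < p'"
      and P: "P p c" "P p' c"
    obtain a z where c: "c = (a, z)" by (cases c)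
    show False
    proof (cases z)
      case None
      with P p(3) c show False by (simp add: P_def)
    next
      case (Some xb)
      obtain x b where xb: "xb = (x, b)" by (cases xb)
      show False
      proof (cases b)
        case True
        have h: "p' < a" "a \<le> target p'" "{a..target p} \<subseteq> J" "a \<le> target p"
          "x \<in> Y" "(p, target p) \<in> clk x" "(p', target p') \<in> clk x"
          using P c Some xb True by (auto simp: P_def)
        \<comment> \<open>The position \<open>p' - 1\<close> lies between two sources of
          \<open>x\<close>, so its target lies between \<open>target p'\<close> and
          \<open>target p\<close>, inside \<open>J\<close>. Thus \<open>p' - 1\<close> is claimed
          and \<open>p'\<close> starts no run.\<close>
        have "p \<le> p' - 1" "p' - 1 \<le> p'" "p' \<le> target p" using h p(3) by auto
        from target_block(2,3)[OF h(5,6,7) this] have "target (p' - 1) \<in> J" using h by auto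
        then show False using p(2,3) by (auto simp: starts_def claim_def)
      next
        case False
        have h: "a < p" "{a..target p} \<subseteq> J" "{a..target p'} \<subseteq> J" "x \<in> Y"
          "(p - 1, target (p - 1)) \<in> clk x" "(p' - 1, target (p' - 1)) \<in> clk x"
          using P c Some xb False by (auto simp: P_def)
        have out: "target (p - 1) \<notin> J" "target (p' - 1) \<notin> J"
          using p h(1) by (auto simp: starts_def claim_def)
        have ge: "a \<le> target (p - 1)" "a \<le> target (p' - 1)"
          using h(1) p(3) target_ge[of "p - 1"] target_ge[of "p' - 1"] by linarith+
        \<comment> \<open>The interval from \<open>a\<close> to \<open>target p'\<close> lies in
          \<open>J\<close>, so the target of \<open>p - 1\<close>, being outside, is beyond it. Then
          \<open>p\<close> lies in the block between the two sources, and
          \<open>target (p' - 1)\<close> is at most \<open>target p\<close>, hence in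
          \<open>J\<close>.\<close>
        have "target p' < target (p - 1)" using out(1) ge(1) h(3) by (meson atLeastAtMost_iff not_le subsetD)
        then have "p - 1 \<le> p" "p \<le> p' - 1" "p' - 1 \<le> target (p - 1)"
          using p(3) target_ge[of p'] by linarith+
        from target_block(2)[OF h(4,5,6) this] have "target (p' - 1) \<in> J" using ge(2) h(2) by auto
        with out(2) show False ..
      qed
    qed
  qed (use fin Y in simp)
  also have "card ?T = card (starts J) * (2 * card Y + 1)"
    using fin Y by (simp add: card_cartesian_product card_image card_insert_if image_iff)
  finally show ?thesis .
qed

text \<open>Apart from position \<open>0\<close>, a change is due to some phase
  \<open>c \<ge> 1\<close>: either \<open>c\<close> begins, or a stretch of sources of one clock
  given to \<open>c\<close> from before it begins or ends. This gives
  \<open>1 + (k * n - 1) * (1 + 2 * card Y)\<close>, since phase \<open>0\<close> receives nothing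
  from before.\<close>

lemma card_phase_changes:
  "card {p. p < N \<and> (p = 0 \<or> phase (target p) \<noteq> phase (target (p - 1)))}
     \<le> k * n + 2 * (k * n - 1) * card Y"
proof -
  let ?S = "{p. p < N \<and> (p = 0 \<or> phase (target p) \<noteq> phase (target (p - 1)))}"
  let ?T = "{None} \<union> Some ` ({1..<k * n} \<times> ({None} \<union> Some ` (Y \<times> (UNIV :: bool set))))"
  define moved where "moved x c p \<longleftrightarrow>
    x \<in> Y \<and> (p, target p) \<in> clk x \<and> phase p < c \<and> phase (target p) = c" for x c p
  define P where "P p c = (case c of None \<Rightarrow> p = 0
     | Some (c, None) \<Rightarrow> 0 < p \<and> phase p = c \<and> phase (p - 1) \<noteq> c
     | Some (c, Some (x, True)) \<Rightarrow> 0 < p \<and> moved x c p \<and> phase (target (p - 1)) \<noteq> c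
     | Some (c, Some (x, False)) \<Rightarrow> 0 < p \<and> moved x c (p - 1) \<and> phase (target p) \<noteq> c)"
    for p and c :: "(nat \<times> ('c \<times> bool) option) option"
  \<comment> \<open>The later source \<open>p'\<close> is in a phase before \<open>c\<close>, hence
    before \<open>target p\<close>; so \<open>target_block\<close> applies and puts
    \<open>target m\<close> between two targets in phase \<open>c\<close>.\<close>
  have between: "phase (target m) = c"
    if "moved x c p" "moved x c p'" "p \<le> m" "m \<le> p'" "p' < N" for x c p p' m
  proof -
    have "p' \<le> target p"
      using that(1,2,5) phase_mono[of "target p" p'] unfolding moved_def by linarith
    from target_block(2,3)[OF _ _ _ that(3,4) this] that(1,2)
    have "target p' \<le> target m" "target m \<le> target p" unfolding moved_def by blast+
    moreover have "target p < N" using target_less_iff that(3-5) by simp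
    ultimately show ?thesis
      using that(1,2) phase_mono[of "target p'" "target m"] phase_mono[of "target m" "target p"]
      unfolding moved_def by linarith
  qed
  have moved: "\<exists>x. moved x (phase (target p)) p \<and> phase (target p) \<in> {1..<k * n}"
    if "p < N" "phase (target p) \<noteq> phase p" for p
  proof (rule target_cases[of p])
    fix x assume x: "x \<in> Y" "(p, target p) \<in> clk x" "p < target p"
    have "target p < N" using that target_less_iff by simp
    then have "phase p < phase (target p)" "phase (target p) < k * n"
      using phase_mono[of p "target p"] x(3) that(2) phase_less by (auto simp: le_neq_implies_less)
    with x show ?thesis unfolding moved_def by auto
  qed (use that in simp)
  have "card ?S \<le> card ?T"
  proof (rule card_le_card_tags[where P = P])
    fix p assume p: "p \<in> ?S"
    \<comment> \<open>The end of a stretch at \<open>p - 1\<close> is charged first, then the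
      beginning of one at \<open>p\<close>; only if both positions stay in their own phases does the
      phase itself change.\<close>
    consider "p = 0" | "0 < p" "phase (target (p - 1)) \<noteq> phase (p - 1)"
      | "0 < p" "phase (target (p - 1)) = phase (p - 1)" "phase (target p) \<noteq> phase p"
      | "0 < p" "phase (target (p - 1)) = phase (p - 1)" "phase (target p) = phase p"
      by blast
    then show "\<exists>c\<in>?T. P p c"
    proof cases
      case 1
      then show ?thesis by (intro bexI[of _ None]) (auto simp: P_def)
    next
      case 2
      then obtain x where "moved x (phase (target (p - 1))) (p - 1)"
        "phase (target (p - 1)) \<in> {1..<k * n}" using moved[of "p - 1"] p less_imp_diff_less by blast
      with 2 p show ?thesis
        by (intro bexI[of _ "Some (phase (target (p - 1)), Some (x, False))"])
          (auto simp: P_def, auto simp: moved_def)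
    next
      case 3
      then obtain x where "moved x (phase (target p)) p"
        "phase (target p) \<in> {1..<k * n}" using moved[of p] p by auto
      with 3 p show ?thesis
        by (intro bexI[of _ "Some (phase (target p), Some (x, True))"])
          (auto simp: P_def, auto simp: moved_def)
    next
      case 4
      have "phase (p - 1) < phase p" "phase p < k * n"
        using 4 p phase_mono[of "p - 1" p] phase_less by (auto simp: le_neq_implies_less)
      with 4 show ?thesis
        by (intro bexI[of _ "Some (phase p, None)"]) (auto simp: P_def)
    qed
  next
    fix p p' c assume p: "p \<in> ?S" "p' \<in> ?S" "p < p'" and P: "P p c" "P p' c"
    have m: "p \<le> p' - 1" "p' - 1 \<le> p'" "p - 1 \<le> p" "p' < N" "p' - 1 < N" using p by auto
    show False
    proof (cases c)
      case None
      with P p(3) show False by (simp add: P_def)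
    next
      case c: (Some cz)
      obtain d z where cz: "cz = (d, z)" by (cases cz)
      show False
      proof (cases z)
        case None
        then have "phase p = d" "phase p' = d" "phase (p' - 1) \<noteq> d"
          using P c cz by (auto simp: P_def)
        then show False
          using phase_mono[OF m(1,5)] phase_mono[OF m(2,4)] by linarith
      next
        case (Some xb)
        obtain x b where xb: "xb = (x, b)" by (cases xb)
        show False
        proof (cases b)
          case True
          then have "moved x d p" "moved x d p'" "phase (target (p' - 1)) \<noteq> d"
            using P c cz Some xb by (auto simp: P_def)
          then show False using between m(1,2,4) by blast
        next
          case False
          then have "moved x d (p - 1)" "moved x d (p' - 1)" "phase (target p) \<noteq> d"
            using P c cz Some xb by (auto simp: P_def)
          then show False using between m(1,3,5) by blast
        qed
      qed
    qed
  qed (use Y in simp)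
  also have "card ?T = 1 + (k * n - 1) * (1 + 2 * card Y)"
    using Y by (simp add: card_cartesian_product card_image card_insert_if image_iff)
  also have "\<dots> = k * n + 2 * (k * n - 1) * card Y"
    using k n by (simp add: algebra_simps)
  finally show ?thesis .
qed

lemma claim_Un: "claim (A \<union> B) = claim A \<union> claim B"
  and claim_disjoint: "A \<inter> B = {} \<Longrightarrow> claim A \<inter> claim B = {}"
  by (auto simp: claim_def)

lemma claim_pair: "(i, j) \<in> stk \<Longrightarrow> claim {i, j} = {i, j}"
proof -
  assume ij: "(i, j) \<in> stk"
  have "p \<in> {i, j}" if p: "target p \<in> {i, j}" for p
  proof (rule target_cases[of p])
    fix x assume "x \<in> Y" "(p, target p) \<in> clk x"
    then have "p = i" using simple[of p "target p" i j] p ij by auto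
    then show ?thesis by simp
  qed (use p in auto)
  then show ?thesis using target_stk[OF ij] by (auto simp: claim_def)
qed

end

section \<open>The decomposition strategy\<close>

text \<open>\<open>good\<close> stands for the sets that can be taken apart into atoms within width
  \<open>K\<close>. In \<open>good_union\<close> the runs of \<open>A\<close> and \<open>B\<close>
  are counted separately, since runs that touch are first cut apart.\<close>

locale splitting_game = round_positions +
  fixes K :: nat and good :: "nat set \<Rightarrow> bool"
  assumes good_point: "p < N \<Longrightarrow> good {p}"
    and good_pair: "(p, q) \<in> constrs \<Longrightarrow> good {p, q}"
    and good_union: "A \<inter> B = {} \<Longrightarrow> constrs \<inter> (A \<times> B \<union> B \<times> A) = {} \<Longrightarrow>
      good A \<Longrightarrow> good B \<Longrightarrow> card (starts A) + card (starts B) \<le> K \<Longrightarrow> good (A \<union> B)"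
    and K: "k * n + 2 * (k * n - 1) * card Y \<le> K" "(k + 2) * (2 * card Y + 1) \<le> K"
begin

text \<open>A nonempty \<open>J\<close> claims nothing if all its positions are clock sources with
  targets outside. The empty set has no decomposition into atoms and is accepted separately.\<close>

definition winning :: "nat set \<Rightarrow> bool" where
  "winning J \<longleftrightarrow> claim J = {} \<or> good (claim J)"

text \<open>Stack constraints stay on one side because \<open>A\<close> is closed and
  \<open>target\<close> fixes their ends; clock constraints do because \<open>target\<close> is
  idempotent.\<close>

lemma winning_Un:
  assumes "closed_in stk A" "A \<inter> B = {}" "winning A" "winning B"
    and "card (starts (claim A)) + card (starts (claim B)) \<le> K"
  shows "winning (A \<union> B)"
proof -
  have "p \<in> claim A \<longleftrightarrow> q \<in> claim A" if pq: "(p, q) \<in> constrs" for p q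
  proof (cases "(p, q) \<in> stk")
    case True
    then show ?thesis using assms(1) target_stk by (fastforce simp: closed_in_def claim_def)
  next
    case False
    with pq obtain x where "x \<in> Y" "(p, q) \<in> clk x" by blast
    then have "target p = q" by (rule target_eq)
    then show ?thesis using target_target[of p] by (simp add: claim_def)
  qed
  then have "constrs \<inter> (claim A \<times> claim B \<union> claim B \<times> claim A) = {}"
    using claim_disjoint[OF assms(2)] by blast
  then show ?thesis
    using good_union[OF claim_disjoint[OF assms(2)]] assms(3-5)
    unfolding winning_def claim_Un by (metis Un_empty_left Un_empty_right)
qed

lemma card_claim_le:
  assumes "finite A" "finite B" "card (starts A) + card (starts B) \<le> k + 2"
  shows "card (starts (claim A)) + card (starts (claim B)) \<le> K"
proof -
  have "card (starts (claim A)) + card (starts (claim B))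
      \<le> (card (starts A) + card (starts B)) * (2 * card Y + 1)"
    using card_starts_claim[OF assms(1)] card_starts_claim[OF assms(2)]
    by (simp add: add_mult_distrib)
  also have "\<dots> \<le> (k + 2) * (2 * card Y + 1)" using assms(3) by (rule mult_right_mono) simp
  also have "\<dots> \<le> K" by (rule K)
  finally show ?thesis .
qed

text \<open>Strong induction on the size of \<open>J\<close>: every smaller set passed on again has
  at most \<open>k\<close> intervals, although the two sides of a stack source together may have
  \<open>k + 1\<close>.\<close>

lemma winning_stack:
  assumes "J \<subseteq> {..<N}" "closed_in stk J" "\<And>p. p \<in> J \<Longrightarrow> phase p mod n = s" "card (starts J) \<le> k"
  shows "winning J"
  using assms
proof (induction "card J" arbitrary: J rule: less_induct)
  case less
  have fin: "finite J" using less.prems(1) finite_subset by blast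
  show ?case
  proof (cases "J = {}")
    case True
    then show ?thesis by (simp add: winning_def claim_def)
  next
    case False
    define j where "j = Max J"
    have j: "j \<in> J" "\<And>p. p \<in> J \<Longrightarrow> p \<le> j" using False fin by (auto simp: j_def)
    have IH: "winning J'" if "J' \<subset> J" "closed_in stk J'" "card (starts J') \<le> k" for J'
      using that less.prems fin by (intro less.hyps) (auto intro: psubset_card_mono)
    have rest: "card (starts (J - {j})) \<le> card (starts J)"
      using finite_starts[OF fin] starts_remove_max[OF j(2)] by (rule card_mono)
    have last: "winning (J - {j})" if "\<And>i. (i, j) \<notin> stk" "closed_in stk (J - {j})"
      using that j(1) rest less.prems(4) by (intro IH) auto
    \<comment> \<open>As the last position, \<open>j\<close> cannot open a stack constraint, whose
      target would lie in \<open>J\<close> beyond it.\<close>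
    have no_source: "(j, l) \<notin> stk" for l
    proof
      assume jl: "(j, l) \<in> stk"
      then have "l \<in> J" using less.prems(2) j(1) by (auto simp: closed_in_def)
      then show False using j(2) lt[of j l] jl by fastforce
    qed
    show ?thesis
    proof (cases "\<exists>i. (i, j) \<in> stk")
      case True
      then obtain i where ij: "(i, j) \<in> stk" by blast
      then have i: "i \<in> J" "i < j"
        using less.prems(2) j(1) lt[of i j] by (auto simp: closed_in_def)
      let ?A = "J \<inter> {..<i}" and ?B = "J \<inter> {i<..<j}"
      have "p \<in> (?A \<union> ?B) \<union> {i, j}" if "p \<in> J" for p using j(2)[OF that] that by auto
      then have "J \<subseteq> (?A \<union> ?B) \<union> {i, j}" by (rule subsetI)
      moreover have "(?A \<union> ?B) \<union> {i, j} \<subseteq> J" using i(1) j(1) by auto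
      ultimately have J: "J = (?A \<union> ?B) \<union> {i, j}" by (rule equalityI)
      have other: "p \<notin> {i, j} \<and> q \<notin> {i, j}" if "(p, q) \<in> stk" "(p, q) \<noteq> (i, j)" for p q
      proof -
        have "{p, q} \<inter> {i, j} = {}" using simple[OF UnI1 UnI1, OF that(1) ij] that(2) by blast
        then show ?thesis by blast
      qed
      have side: "p \<in> J \<Longrightarrow> p < i \<longleftrightarrow> q < i" and mem: "p \<in> J \<longleftrightarrow> q \<in> J"
        if pq: "(p, q) \<in> stk" "(p, q) \<noteq> (i, j)" for p q
      proof -
        show mem: "p \<in> J \<longleftrightarrow> q \<in> J" using less.prems(2) pq(1) by (auto simp: closed_in_def)
        assume p: "p \<in> J"
        then have "q \<in> J" using mem by simp
        then have "q \<le> j" by (rule j(2))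
        have "p < q" using lt[of p q] pq(1) by simp
        have "phase p mod n = phase i mod n" using less.prems(3) p i(1) by simp
        \<comment> \<open>A stack constraint reaching over \<open>i\<close> would have to close
          after \<open>j\<close>, by well-nestedness, but \<open>j\<close> is the last position of
          \<open>J\<close>.\<close>
        then have "\<not> (p < i \<and> i < q)"
          using stk_nested[OF pq(1) ij] \<open>q \<le> j\<close> by auto
        then show "p < i \<longleftrightarrow> q < i" using \<open>p < q\<close> other[OF pq] by auto
      qed
      have cl: "closed_in stk ?A" "closed_in stk ?B"
      proof -
        have "(p \<in> ?A \<longleftrightarrow> q \<in> ?A) \<and> (p \<in> ?B \<longleftrightarrow> q \<in> ?B)" if pq: "(p, q) \<in> stk" for p q
        proof (cases "(p, q) = (i, j)")
          case False
          have "p \<noteq> i" "q \<noteq> i" "p \<noteq> j" "q \<noteq> j" using other[OF pq False] by auto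
          with side[OF pq False] mem[OF pq False] j(2)[of p] j(2)[of q] show ?thesis by auto
        qed (use i in auto)
        then show "closed_in stk ?A" "closed_in stk ?B" by (auto simp: closed_in_def)
      qed
      note split = card_starts_split[OF fin i(1)]
      have "(?A \<union> ?B) \<inter> {i, j} = {}" using i(2) by auto
      moreover have "closed_in stk (?A \<union> ?B)" using cl by (auto simp: closed_in_def)
      moreover have "winning {i, j}"
        using good_pair ij by (simp add: winning_def claim_pair)
      moreover have "winning (?A \<union> ?B)"
      proof (rule winning_Un)
        have "?A \<subset> J" "?B \<subset> J" using i(1) by auto
        then show "winning ?A" "winning ?B"
          using cl split(1) split(2)[of j] less.prems(4) by (intro IH; simp)+
        show "card (starts (claim ?A)) + card (starts (claim ?B)) \<le> K"
          using fin split(3)[of j] less.prems(4) by (intro card_claim_le) auto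
      qed (use cl in auto)
      \<comment> \<open>The pair claims only itself and costs \<open>2\<close>, which is at most
        \<open>2 * card Y + 1\<close> because \<open>Y\<close> is nonempty. Bounding it by
        \<open>card_starts_claim\<close> could amount to \<open>k + 3\<close> intervals.\<close>
      moreover have "card (starts (claim (?A \<union> ?B))) + card (starts (claim {i, j})) \<le> K"
      proof -
        have "card (starts (?A \<union> ?B)) \<le> card (starts ?A \<union> starts ?B)"
          using fin by (intro card_mono starts_Un) (simp add: finite_starts)
        also have "\<dots> \<le> k + 1"
          using card_Un_le[of "starts ?A" "starts ?B"] split(3)[of j] less.prems(4) by linarith
        finally have "card (starts (?A \<union> ?B)) * (2 * card Y + 1) \<le> (k + 1) * (2 * card Y + 1)"
          by (rule mult_right_mono) simp
        moreover have "card (starts (claim (?A \<union> ?B))) \<le> card (starts (?A \<union> ?B)) * (2 * card Y + 1)"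
          using fin by (intro card_starts_claim) simp
        ultimately have "card (starts (claim (?A \<union> ?B))) \<le> (k + 1) * (2 * card Y + 1)"
          by (rule order_trans[rotated])
        moreover have "card (starts {i, j}) \<le> card {i, j}"
          by (intro card_mono starts_subset) simp
        then have "card (starts (claim {i, j})) \<le> 2"
          using i(2) by (simp add: claim_pair[OF ij])
        moreover have "card Y \<ge> 1" using Y by (simp add: Suc_le_eq card_gt_0_iff)
        ultimately show ?thesis using K(2) by (simp add: algebra_simps)
      qed
      ultimately have "winning ((?A \<union> ?B) \<union> {i, j})"
        by (intro winning_Un[of "?A \<union> ?B" "{i, j}"])
      then show ?thesis using J by simp
    next
      case False
      have cl: "closed_in stk (J - {j})"
        using less.prems(2) no_source False unfolding closed_in_def by blast
      then have rest_win: "winning (J - {j})" using last False by blast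
      \<comment> \<open>If \<open>j\<close> is a clock target, it claims its source as well and the
        two form an atomic pair. If \<open>j\<close> is a clock source, no position has target
        \<open>j\<close>, and dropping \<open>j\<close> leaves the claimed set unchanged.\<close>
      show ?thesis
      proof (cases "target j = j")
        case True
        have "winning {j}"
        proof (cases "\<exists>i. i \<noteq> j \<and> target i = j")
          case True
          then obtain i where i: "i \<noteq> j" "target i = j" by blast
          obtain x where x: "x \<in> Y" "(i, j) \<in> clk x" using target_cases[of i] i by metis
          have "p \<in> {i, j}" if "target p = j" for p
          proof (rule target_cases[of p])
            fix y assume "y \<in> Y" "(p, target p) \<in> clk y"
            then have "p = i" using simple[of p j i j] x that by auto
            then show ?thesis by simp
          qed (use that in simp)
          then have "claim {j} = {i, j}" using i \<open>target j = j\<close> by (auto simp: claim_def)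
          then show ?thesis using good_pair x by (auto simp: winning_def)
        next
          case False
          then have "claim {j} = {j}" using True by (auto simp: claim_def)
          moreover have "j < N" using j(1) less.prems(1) by auto
          ultimately show ?thesis using good_point by (simp add: winning_def)
        qed
        moreover have "card (starts {j}) \<le> card {j}"
          by (intro card_mono starts_subset) simp
        then have "card (starts (claim (J - {j}))) + card (starts (claim {j})) \<le> K"
          using rest less.prems(4) fin by (intro card_claim_le) auto
        ultimately have "winning ((J - {j}) \<union> {j})"
          using cl rest_win by (intro winning_Un) auto
        then show ?thesis using j(1) by (simp add: insert_absorb)
      next
        case False
        have "target p \<noteq> j" for p using target_target[of p] False by metis
        then have "claim (J - {j}) = claim J" by (auto simp: claim_def)
        then show ?thesis using rest_win by (simp add: winning_def)
      qed
    qed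
  qed
qed

text \<open>Phases are numbered round by round, so \<open>phase p div n\<close> is the round. Two
  starts with the same round and stack lie in one phase, and by monotonicity so does everything
  between them.\<close>

lemma card_starts_stack: "card (starts {p. p < N \<and> phase p mod n = s}) \<le> k"
proof -
  let ?J = "{p. p < N \<and> phase p mod n = s}"
  have "card (starts ?J) \<le> card {..<k}"
  proof (rule card_le_card_tags[where P = "\<lambda>p c. phase p div n = c"])
    fix p assume "p \<in> starts ?J"
    then show "\<exists>c\<in>{..<k}. phase p div n = c"
      using phase_less n by (auto simp: starts_def less_mult_imp_div_less)
  next
    fix p p' c assume p: "p \<in> starts ?J" "p' \<in> starts ?J" "p < p'"
      and c: "phase p div n = c" "phase p' div n = c"
    have "p < N" "p' < N" "phase p mod n = s" "phase p' mod n = s" "p' - 1 \<notin> ?J"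
      using p by (auto simp: starts_def)
    then have "phase p = phase p'" using c by (metis div_mult_mod_eq)
    moreover have "phase p \<le> phase (p' - 1)" "phase (p' - 1) \<le> phase p'"
      using phase_mono[of p "p' - 1"] phase_mono[of "p' - 1" p'] p(3) \<open>p' < N\<close> by auto
    ultimately have "phase (p' - 1) = phase p'" by simp
    then show False using \<open>p' - 1 \<notin> ?J\<close> \<open>p' < N\<close> \<open>phase p' mod n = s\<close> by auto
  qed simp
  then show ?thesis by simp
qed

text \<open>Stacks are joined one at a time. Every start on either side is a position where the
  phase of \<open>target\<close> changes, so \<open>card_phase_changes\<close> bounds both sides
  together.\<close>

lemma winning_stacks: "m \<le> n \<Longrightarrow> winning {p. p < N \<and> phase p mod n < m}"
proof (induction m)
  case 0
  then show ?case by (simp add: winning_def claim_def)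
next
  case (Suc m)
  let ?A = "{p. p < N \<and> phase p mod n < m}" and ?B = "{p. p < N \<and> phase p mod n = m}"
  let ?S = "{p. p < N \<and> (p = 0 \<or> phase (target p) \<noteq> phase (target (p - 1)))}"
  have cl: "closed_in stk ?A" "closed_in stk ?B"
    using stk_phase lt by (fastforce simp: closed_in_def)+
  have "card (starts (claim ?A)) + card (starts (claim ?B))
      = card (starts (claim ?A) \<union> starts (claim ?B))"
  proof (rule card_Un_disjoint[symmetric])
    have "claim ?A \<subseteq> {..<N}" "claim ?B \<subseteq> {..<N}"
      using target_less_iff by (auto simp: claim_def)
    then show "finite (starts (claim ?A))" "finite (starts (claim ?B))"
      by (meson finite_lessThan finite_subset finite_starts)+
    show "starts (claim ?A) \<inter> starts (claim ?B) = {}"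
      by (auto simp: starts_def claim_def)
  qed
  also have "\<dots> \<le> card ?S"
  proof (rule card_mono)
    show "starts (claim ?A) \<union> starts (claim ?B) \<subseteq> ?S"
    proof
      fix p assume "p \<in> starts (claim ?A) \<union> starts (claim ?B)"
      then have p: "p < N" and "p = 0 \<or> phase (target p) \<noteq> phase (target (p - 1)) \<or> \<not> p - 1 < N"
        by (auto simp: starts_def claim_def target_less_iff)
      then show "p \<in> ?S" by auto
    qed
  qed simp
  also have "\<dots> \<le> K" using card_phase_changes K(1) by linarith
  finally have "card (starts (claim ?A)) + card (starts (claim ?B)) \<le> K" .
  moreover have "winning ?A" using Suc by simp
  moreover have "winning ?B" using cl(2) card_starts_stack[of m] by (intro winning_stack) auto
  moreover have "?A \<inter> ?B = {}" by auto
  ultimately have "winning (?A \<union> ?B)" by (intro winning_Un[OF cl(1)])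
  moreover have "?A \<union> ?B = {p. p < N \<and> phase p mod n < Suc m}" by auto
  ultimately show ?case by simp
qed

theorem good_all:
  assumes "0 < N"
  shows "good {..<N}"
proof -
  have "{p. p < N \<and> phase p mod n < n} = {..<N}" using n by auto
  then have "winning {..<N}" using winning_stacks[of n] by simp
  moreover have "claim {..<N} = {..<N}" using target_less_iff by (auto simp: claim_def)
  ultimately show ?thesis using assms by (auto simp: winning_def)
qed

end

section \<open>From words to positions\<close>

text \<open>Read upwards, \<open>cut\<close> restores one edge; repeating it joins blocks that
  touch.\<close>

lemma splits_add_edges:
  assumes "splits W K C E" "finite F" "F \<subseteq> succ W \<inter> C \<times> C" "E \<subseteq> succ W \<inter> C \<times> C"
  shows "splits W K C (E \<union> F)"
  using assms(2,3)
proof induction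
  case (insert f F)
  show ?case
  proof (cases "f \<in> E")
    case True
    with insert show ?thesis by (simp add: insert_absorb)
  next
    case False
    then have "E \<union> insert f F - {f} = E \<union> F" using insert.hyps by auto
    then have "splits W K C (E \<union> insert f F - {f})" using insert by simp
    moreover have "E \<union> insert f F \<subseteq> succ W \<inter> C \<times> C" using insert.prems assms(4) by blast
    moreover have "f \<in> E \<union> insert f F" by simp
    ultimately show ?thesis using splits.cut by metis
  qed
qed (use assms in simp)

context ranked_tcw
begin

section \<open>Positions as numbers, blocks as runs\<close>

abbreviation N :: nat where
  "N \<equiv> card (verts W)"

definition pos :: "nat \<Rightarrow> 'v" where
  "pos = inv_into (verts W) r"

lemma pos_in: "p < N \<Longrightarrow> pos p \<in> verts W"
  unfolding pos_def using bij_betwE[OF bij_betw_inv_into[OF bij_rank]] by simp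

lemma rank_pos: "p < N \<Longrightarrow> r (pos p) = p"
  unfolding pos_def using bij_betw_inv_into_right[OF bij_rank] by simp

lemma rank_less: "v \<in> verts W \<Longrightarrow> r v < N"
  using bij_betwE[OF bij_rank] by simp

lemma pos_rank: "v \<in> verts W \<Longrightarrow> pos (r v) = v"
  unfolding pos_def by (rule bij_betw_inv_into_left[OF bij_rank])

lemma inj_pos: "inj_on pos {..<N}"
  by (rule inj_on_inverseI[of _ r]) (simp add: rank_pos)

lemma pos_image: "pos ` {..<N} = verts W"
  unfolding pos_def using bij_betw_inv_into[OF bij_rank] by (simp add: bij_betw_def)

lemma lt_pos: "p < N \<Longrightarrow> q < N \<Longrightarrow> (pos p, pos q) \<in> lt W \<longleftrightarrow> p < q"
  by (simp add: lt_rank pos_in rank_pos)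

lemma rank_succ:
  assumes "(u, v) \<in> succ W"
  shows "r v = Suc (r u)"
proof (rule ccontr)
  assume ne: "r v \<noteq> Suc (r u)"
  have uv: "v \<in> verts W" "r u < r v" and no: "\<forall>w\<in>verts W. \<not> (r u < r w \<and> r w < r v)"
    using assms unfolding succ_direct direct_succ_rank_order[OF inj_rank] by auto
  then have "Suc (r u) < r v" using ne by simp
  then have "Suc (r u) < N" using rank_less[OF uv(1)] by simp
  then show False using no pos_in rank_pos \<open>Suc (r u) < r v\<close> by fastforce
qed

lemma succ_pos: "Suc p < N \<Longrightarrow> (pos p, pos (Suc p)) \<in> succ W"
  unfolding succ_direct direct_succ_rank_order[OF inj_rank] by (simp add: pos_in rank_pos)

text \<open>With every available edge present, the blocks on \<open>C\<close> are its maximal runs,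
  and heads correspond to starts.\<close>

definition links :: "nat set \<Rightarrow> ('v \<times> 'v) set" where
  "links C = {(pos p, pos (Suc p)) |p. p \<in> C \<and> Suc p \<in> C}"

lemma links_subset:
  assumes "C \<subseteq> {..<N}"
  shows "links C \<subseteq> succ W \<inter> pos ` C \<times> pos ` C"
  using assms succ_pos unfolding links_def by auto

lemma links_all: "links {..<N} = succ W"
proof
  show "links {..<N} \<subseteq> succ W" using links_subset by blast
  show "succ W \<subseteq> links {..<N}"
  proof
    fix e assume e: "e \<in> succ W"
    obtain u v where uv: "e = (u, v)" by (cases e)
    then have "u \<in> verts W" "v \<in> verts W" "r v = Suc (r u)"
      using e succ_rank rank_succ by auto
    then show "e \<in> links {..<N}"
      unfolding links_def uv using pos_rank[of u] pos_rank[of v] rank_less[of u] rank_less[of v]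
      by (intro CollectI exI[of _ "r u"]) auto
  qed
qed

lemma heads_links:
  assumes "C \<subseteq> {..<N}"
  shows "heads (pos ` C) (links C) = pos ` starts C"
proof -
  have "pos p \<in> snd ` links C \<longleftrightarrow> 0 < p \<and> p - 1 \<in> C" if "p \<in> C" for p
  proof
    assume "pos p \<in> snd ` links C"
    then obtain q where q: "q \<in> C" "Suc q \<in> C" "pos p = pos (Suc q)" by (auto simp: links_def)
    then have "p = Suc q" using inj_onD[OF inj_pos, of p "Suc q"] that assms by auto
    with q show "0 < p \<and> p - 1 \<in> C" by simp
  next
    assume p: "0 < p \<and> p - 1 \<in> C"
    then have "(pos (p - 1), pos p) \<in> links C"
      using that by (auto simp: links_def intro!: exI[of _ "p - 1"])
    then show "pos p \<in> snd ` links C" by force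
  qed
  then show ?thesis unfolding heads_def starts_def by auto
qed

definition playable :: "nat \<Rightarrow> nat set \<Rightarrow> bool" where
  "playable K C \<longleftrightarrow> C \<subseteq> {..<N} \<and> splits W K (pos ` C) (links C)"

text \<open>The two parts are first put together without edges between them, where the heads are at
  most the starts of both; the missing edges are restored afterwards.\<close>

lemma playable_Un:
  assumes disj: "A \<inter> B = {}" and play: "playable K A" "playable K B"
    and constr: "all_constr W \<inter> (pos ` A \<times> pos ` B \<union> pos ` B \<times> pos ` A) = {}"
    and K: "card (starts A) + card (starts B) \<le> K"
  shows "playable K (A \<union> B)"
proof -
  have sub: "A \<subseteq> {..<N}" "B \<subseteq> {..<N}" and AB: "A \<union> B \<subseteq> {..<N}"
    using play unfolding playable_def by auto
  have fin: "finite A" "finite B" using sub finite_subset by blast+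
  have "heads (pos ` A \<union> pos ` B) (links A \<union> links B) \<subseteq> pos ` starts A \<union> pos ` starts B"
    unfolding heads_links[OF sub(1), symmetric] heads_links[OF sub(2), symmetric]
    by (auto simp: heads_def)
  then have "card (heads (pos ` A \<union> pos ` B) (links A \<union> links B))
      \<le> card (pos ` starts A \<union> pos ` starts B)"
    using fin by (intro card_mono) (simp_all add: finite_starts)
  also have "\<dots> \<le> card (pos ` starts A) + card (pos ` starts B)" by (rule card_Un_le)
  also have "\<dots> \<le> card (starts A) + card (starts B)"
    using fin by (intro add_mono card_image_le finite_starts)
  also have "\<dots> \<le> K" by (rule K)
  finally have "splits W K (pos ` A \<union> pos ` B) (links A \<union> links B)"
    using play constr inj_on_image_Int[OF inj_pos sub] disj unfolding playable_def
    by (intro splits.union) auto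
  then have "splits W K (pos ` (A \<union> B)) ((links A \<union> links B) \<union> links (A \<union> B))"
    unfolding image_Un[symmetric]
  proof (rule splits_add_edges)
    show "links (A \<union> B) \<subseteq> succ W \<inter> pos ` (A \<union> B) \<times> pos ` (A \<union> B)"
      by (rule links_subset[OF AB])
    have "links (A \<union> B) \<subseteq> (\<lambda>p. (pos p, pos (Suc p))) ` (A \<union> B)" by (auto simp: links_def)
    then show "finite (links (A \<union> B))" using fin by (auto intro: finite_subset)
    show "links A \<union> links B \<subseteq> succ W \<inter> pos ` (A \<union> B) \<times> pos ` (A \<union> B)"
      using links_subset[OF sub(1)] links_subset[OF sub(2)] by blast
  qed
  moreover have "(links A \<union> links B) \<union> links (A \<union> B) = links (A \<union> B)"
    by (auto simp: links_def)
  ultimately show ?thesis using AB by (simp add: playable_def)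
qed

lemma split_width_le_of_playable:
  "playable K {..<N} \<Longrightarrow> split_width \<Sigma> \<I> (split_of_tcw W) \<le> enat K"
  unfolding playable_def links_all pos_image by (elim conjE, rule split_width_le)

section \<open>Transfer of the clock and stack conditions to positions\<close>

definition pull :: "('v \<times> 'v) set \<Rightarrow> (nat \<times> nat) set" where
  "pull R = {(p, q). p < N \<and> q < N \<and> (pos p, pos q) \<in> R}"

text \<open>Ranks grow by exactly one along a block, so the distance of \<open>v\<close> from the
  first element is its index in \<open>b\<close>.\<close>

lemma reset_block_interval:
  assumes "reset_block W R b" "Domain R \<subseteq> verts W" "u \<in> set b" "w \<in> set b"
    and v: "v \<in> verts W" "r u \<le> r v" "r v \<le> r w"
  shows "v \<in> set b"
proof -
  have succ: "(b ! i, b ! Suc i) \<in> succ W" if "Suc i < length b" for i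
    using assms(1) that unfolding reset_block_def successively_conv_nth by blast
  have rank: "r (b ! i) = r (b ! 0) + i" if "i < length b" for i
    using that by (induction i) (use rank_succ[OF succ] in auto)
  obtain a c where ac: "a < length b" "u = b ! a" "c < length b" "w = b ! c"
    using assms(3,4) by (metis in_set_conv_nth)
  define i where "i = r v - r (b ! 0)"
  have i: "i < length b" "r v = r (b ! 0) + i" using v ac rank[of a] rank[of c] by (auto simp: i_def)
  then have "r v = r (b ! i)" using rank by simp
  moreover have "b ! i \<in> verts W"
    using assms(1,2) nth_mem[OF i(1)] unfolding reset_block_def by blast
  ultimately have "v = b ! i" using inj_onD[OF inj_rank] v(1) by blast
  then show ?thesis using i(1) by simp
qed

text \<open>For \<open>i < i'\<close>, the bound \<open>i' \<le> j\<close> excludes different reset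
  blocks. A block is an interval, so \<open>m\<close> is a source in it too, and the nesting
  condition applies to \<open>i\<close>, \<open>m\<close> and to \<open>m\<close>,
  \<open>i'\<close>.\<close>

lemma clock_timed_pull:
  assumes R: "clock_timed W R" "R \<subseteq> lt W" "single_valued R"
    and ij: "(i, j) \<in> pull R" "(i', j') \<in> pull R" and m: "i \<le> m" "m \<le> i'" "i' \<le> j"
  shows "\<exists>l. (m, l) \<in> pull R \<and> j' \<le> l \<and> l \<le> j"
proof (cases "i = i'")
  case True
  then have "pos j = pos j'" using ij R(3) by (auto simp: pull_def dest: single_valuedD)
  then have "j = j'" using ij inj_onD[OF inj_pos, of j j'] by (auto simp: pull_def)
  with True ij m show ?thesis by auto
next
  case False
  have N: "i < N" "j < N" "i' < N" "j' < N" "m < N" using ij m by (auto simp: pull_def)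
  have timed: "if same_reset_block W R (pos p) (pos p') then p' < q' \<and> q' < q else q < p'"
    if "(p, q) \<in> pull R" "(p', q') \<in> pull R" "p < p'" for p q p' q'
  proof -
    have "p < N" "q < N" "p' < N" "q' < N" "(pos p, pos q) \<in> R" "(pos p', pos q') \<in> R"
      using that by (auto simp: pull_def)
    moreover from this have "if same_reset_block W R (pos p) (pos p')
       then (pos p', pos q') \<in> lt W \<and> (pos q', pos q) \<in> lt W else (pos q, pos p') \<in> lt W"
      using R(1) that(3) lt_pos unfolding clock_timed_def by blast
    ultimately show ?thesis by (auto simp: lt_pos split: if_splits)
  qed
  have "same_reset_block W R (pos i) (pos i')" and "j' < j"
    using timed[OF ij] False m by (auto split: if_splits)
  then obtain b where b: "reset_block W R b" "pos i \<in> set b" "pos i' \<in> set b"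
    unfolding same_reset_block_def by blast
  have dom: "Domain R \<subseteq> verts W" using R(2) lt_rank by auto
  have "pos m \<in> set b"
    using reset_block_interval[OF b(1) dom b(2,3)] N m by (simp add: rank_pos pos_in)
  then have same: "same_reset_block W R (pos i) (pos m)" "same_reset_block W R (pos m) (pos i')"
    using b unfolding same_reset_block_def by blast+
  consider "m = i" | "m = i'" | "i < m" "m < i'" using m by linarith
  then show ?thesis
  proof cases
    case 3
    obtain v where v: "(pos m, v) \<in> R"
      using \<open>pos m \<in> set b\<close> b(1) unfolding reset_block_def by blast
    then have "v \<in> verts W" using R(2) by (auto simp: lt_rank)
    then have "(m, r v) \<in> pull R" using v N rank_less pos_rank by (simp add: pull_def)
    then show ?thesis using timed[OF ij(1), of m "r v"] timed[OF _ ij(2), of m "r v"] same 3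
      by (intro exI[of _ "r v"]) auto
  qed (use ij \<open>j' < j\<close> in auto)
qed

text \<open>Numbering phases lexicographically by round and stack, both counted from zero, makes the
  number monotone along the word and its remainder modulo \<open>n\<close> the stack.\<close>

lemma round_phases:
  assumes rounds: "k_round W k n R" and n: "0 < n"
  obtains f where "\<And>v. v \<in> verts W \<Longrightarrow> f v < k * n"
    and "\<And>u v. (u, v) \<in> lt W \<Longrightarrow> f u \<le> f v"
    and "\<And>s u v. s \<in> {1..n} \<Longrightarrow> (u, v) \<in> R s \<Longrightarrow> u \<in> verts W \<Longrightarrow> v \<in> verts W \<Longrightarrow>
      f u mod n = s - 1 \<and> f v mod n = s - 1"
proof -
  obtain U P where U: "verts W = (\<Union>l\<in>{1..k}. U l)"
      "\<forall>l\<in>{1..k}. \<forall>m\<in>{1..k}. l < m \<longrightarrow> U l \<times> U m \<subseteq> lt W"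
    and P: "\<forall>l\<in>{1..k}. U l = (\<Union>s\<in>{1..n}. P l s) \<and> disjoint_family_on (P l) {1..n} \<and>
      (\<forall>s\<in>{1..n}. \<forall>t\<in>{1..n}. s < t \<longrightarrow> P l s \<times> P l t \<subseteq> lt W) \<and>
      (\<forall>s\<in>{1..n}. \<forall>t\<in>{1..n}. t \<noteq> s \<longrightarrow> (\<forall>(i, j)\<in>R t. i \<notin> P l s \<and> j \<notin> P l s))"
    using rounds unfolding k_round_def by (elim exE conjE) (rule that)
  have phases_lt: "(u, v) \<in> lt W"
    if "l \<in> {1..k}" "s \<in> {1..n}" "t \<in> {1..n}" "s < t" "u \<in> P l s" "v \<in> P l t" for l s t u v
  proof -
    have "P l s \<times> P l t \<subseteq> lt W" using bspec[OF P that(1)] that(2-4) by blast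
    with that(5,6) show ?thesis by blast
  qed
  have phase_stack: "t = s"
    if "l \<in> {1..k}" "s \<in> {1..n}" "t \<in> {1..n}" "(u, v) \<in> R t" "u \<in> P l s \<or> v \<in> P l s" for l s t u v
  proof (rule ccontr)
    assume "t \<noteq> s"
    then have "\<forall>(i, j)\<in>R t. i \<notin> P l s \<and> j \<notin> P l s" using bspec[OF P that(1)] that(2,3) by blast
    with that(4,5) show False by auto
  qed
  have "\<exists>l s. l \<in> {1..k} \<and> s \<in> {1..n} \<and> v \<in> P l s" if v: "v \<in> verts W" for v
  proof -
    obtain l where "l \<in> {1..k}" "v \<in> U l" using v U(1) by auto
    moreover from this P obtain s where "s \<in> {1..n}" "v \<in> P l s" by auto
    ultimately show ?thesis by blast
  qed
  then obtain L S where LS: "\<And>v. v \<in> verts W \<Longrightarrow> L v \<in> {1..k} \<and> S v \<in> {1..n} \<and> v \<in> P (L v) (S v)"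
    by metis
  define f where "f v = (L v - 1) * n + (S v - 1)" for v
  have mod: "f v mod n = S v - 1" if "v \<in> verts W" for v
  proof -
    have "S v - 1 < n" using LS[OF that] by auto
    then show ?thesis by (simp only: f_def mod_mult_self3 mod_less)
  qed
  show ?thesis
  proof
    fix v assume "v \<in> verts W"
    then have "L v - 1 < k" "S v - 1 < n" using LS[of v] by auto
    then have "f v < (L v - 1) * n + n" "(L v - 1 + 1) * n \<le> k * n"
      unfolding f_def by (intro add_strict_left_mono mult_right_mono; simp)+
    then show "f v < k * n" by (simp only: add_mult_distrib mult_1)
  next
    fix u v assume uv: "(u, v) \<in> lt W"
    have V: "u \<in> verts W" "v \<in> verts W" using uv by (auto simp: lt_rank)
    have anti: "(v, u) \<notin> lt W" using uv by (simp add: lt_rank)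
    have "u \<in> U (L u)" "v \<in> U (L v)" using P LS[OF V(1)] LS[OF V(2)] by auto
    then have "\<not> L v < L u" using U(2) LS[OF V(1)] LS[OF V(2)] anti by blast
    then consider "L u < L v" | "L u = L v" by linarith
    then show "f u \<le> f v"
    proof cases
      case 1
      have "S u - 1 \<le> n" using LS[OF V(1)] by auto
      then have "f u \<le> (L u - 1) * n + n" unfolding f_def by (rule add_left_mono)
      also have "\<dots> = L u * n" using LS[OF V(1)] by (cases "L u") auto
      also have "\<dots> \<le> (L v - 1) * n" using 1 by (intro mult_right_mono) auto
      also have "\<dots> \<le> f v" by (simp add: f_def)
      finally show ?thesis .
    next
      case 2
      have "\<not> S v < S u"
        using phases_lt[of "L u" "S v" "S u" v u] LS[OF V(1)] LS[OF V(2)] 2 anti by auto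
      with 2 show ?thesis unfolding f_def by (intro add_mono mult_right_mono diff_le_mono) auto
    qed
  next
    fix s u v assume s: "s \<in> {1..n}" "(u, v) \<in> R s" "u \<in> verts W" "v \<in> verts W"
    have "s = S u" using phase_stack[of "L u" "S u" s u v] LS[OF s(3)] s(1,2) by blast
    moreover have "s = S v" using phase_stack[of "L v" "S v" s u v] LS[OF s(4)] s(1,2) by blast
    ultimately show "f u mod n = s - 1 \<and> f v mod n = s - 1"
      using mod s(3,4) by simp
  qed
qed

end

section \<open>Playing the game on a given word\<close>

theorem lemma6p1:
  fixes \<Sigma> :: "'a set" and \<I> :: "real set set"
    and X Y :: "'c set" and \<zeta> :: 'c
    and k n :: nat
    and W :: "('v, 'a) tcw"
  assumes "finite \<Sigma>"
    and "finite \<I>" and "\<forall>I\<in>\<I>. closed_interval I"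
    and "finite X" and "\<zeta> \<notin> X" and "Y = X \<union> {\<zeta>}"
    and "k \<ge> 1" and "n > 1"
    and "is_tcw \<Sigma> \<I> W" and "simple_tcw W"
    and "k_round_well_timed W k Y n"
  shows "split_width \<Sigma> \<I> (split_of_tcw W)
           \<le> enat (max (k * n + 2 * (k * n - 1) * card Y) ((k + 2) * (2 * card Y + 1)))"
proof -
  have W: "finite (verts W)" "linear_order_on (verts W) (le W)" "verts W \<noteq> {}"
    using assms(9) by (simp_all add: is_tcw_def)
  obtain r where r: "bij_betw r (verts W) {..<card (verts W)}" "le W = rank_order r (verts W)"
    by (rule finite_linear_order_rank[OF W(1,2)])
  interpret ranked_tcw \<Sigma> \<I> W r
    by (rule ranked_tcw.intro[OF assms(9,10) r])
  obtain Q :: "nat + 'c \<Rightarrow> real set \<Rightarrow> ('v \<times> 'v) set" where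
    Q': "\<forall>I. constr W I = (\<Union>z\<in>{1..n} <+> Y. Q z I) \<and> disjoint_family_on (\<lambda>z. Q z I) ({1..n} <+> Y)"
    and nested: "\<forall>s\<in>{1..n}. well_nested W (\<Union>I. Q (Inl s) I)"
    and rounds: "k_round W k n (\<lambda>s. \<Union>I. Q (Inl s) I)"
    and timed: "\<forall>x\<in>Y. clock_timed W (\<Union>I. Q (Inr x) I)"
    using assms(11) unfolding k_round_well_timed_def by (elim exE conjE) (rule that)
  have Q: "constr W I = (\<Union>z\<in>{1..n} <+> Y. Q z I)" "disjoint_family_on (\<lambda>z. Q z I) ({1..n} <+> Y)"
    for I using Q' by simp_all
  define S where "S s = (\<Union>I. Q (Inl s) I)" for s
  define C where "C x = (\<Union>I. Q (Inr x) I)" for x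
  have all: "all_constr W = (\<Union>s\<in>{1..n}. S s) \<union> (\<Union>x\<in>Y. C x)"
    unfolding all_constr_def Q(1) S_def C_def by (simp add: Plus_def UN_Un) blast
  have S_sub: "S s \<subseteq> all_constr W" if "s \<in> {1..n}" for s using that all by blast
  have C_sub: "C x \<subseteq> all_constr W" if "x \<in> Y" for x using that all by blast
  have same: "(u, I, v) = (u', I', v')"
    if uv: "(u, v) \<in> constr W I" "(u', v') \<in> constr W I'" "{u, v} \<inter> {u', v'} \<noteq> {}" for u v u' v' I I'
  proof -
    obtain w where w: "w \<in> {u, v}" "w \<in> {u', v'}" using uv(3) by blast
    have "w \<in> verts W" using w(1) uv(1) constr_lt[of I] by (auto simp: lt_rank)
    then show ?thesis using assms(10) w uv(1,2) unfolding simple_tcw_def by blast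
  qed
  have unique: "(u, v) = (u', v')"
    if "(u, v) \<in> all_constr W" "(u', v') \<in> all_constr W" "{u, v} \<inter> {u', v'} \<noteq> {}" for u v u' v'
    using that same unfolding all_constr_def by blast
  \<comment> \<open>The partition is given for each interval separately, so a common pair might
    carry two intervals; simplicity makes them equal, and then the partition excludes it.\<close>
  have SC: "S s \<inter> C x = {}" if sx: "s \<in> {1..n}" "x \<in> Y" for s x
  proof -
    have "False" if uv: "(u, v) \<in> Q (Inl s) I" "(u, v) \<in> Q (Inr x) I'" for u v I I'
    proof -
      have mem: "Inl s \<in> {1..n} <+> Y" "Inr x \<in> {1..n} <+> Y" using sx by auto
      have "(u, v) \<in> constr W I" "(u, v) \<in> constr W I'" using Q(1) uv mem by blast+
      then have "I = I'" using same[of u v I u v I'] by simp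
      then show False using disjoint_family_onD[OF Q(2) mem, of I] uv by auto
    qed
    then show ?thesis unfolding S_def C_def by auto
  qed
  obtain f where f: "\<And>v. v \<in> verts W \<Longrightarrow> f v < k * n" "\<And>u v. (u, v) \<in> lt W \<Longrightarrow> f u \<le> f v"
    "\<And>s u v. s \<in> {1..n} \<Longrightarrow> (u, v) \<in> S s \<Longrightarrow> u \<in> verts W \<Longrightarrow> v \<in> verts W \<Longrightarrow>
      f u mod n = s - 1 \<and> f v mod n = s - 1"
    using round_phases[OF rounds] assms(8) unfolding S_def by auto
  let ?K = "max (k * n + 2 * (k * n - 1) * card Y) ((k + 2) * (2 * card Y + 1))"
  let ?stk = "\<Union>s\<in>{1..n}. pull (S s)" and ?clk = "\<lambda>x. pull (C x)"
  have constrs: "?stk \<union> (\<Union>x\<in>Y. ?clk x) = pull (all_constr W)"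
    unfolding all pull_def by auto
  have constr_pos: "p < N \<and> q < N \<and> (pos p, pos q) \<in> all_constr W"
    if "(p, q) \<in> ?stk \<union> (\<Union>x\<in>Y. ?clk x)" for p q
    using that[unfolded constrs] by (simp add: pull_def)
  \<comment> \<open>Atomic pairs already have two blocks.\<close>
  have K2: "2 \<le> ?K"
  proof -
    have "2 \<le> (k + 2) * (2 * card Y + 1)" by simp
    then show ?thesis by simp
  qed
  interpret splitting_game N k n Y ?stk ?clk "\<lambda>p. f (pos p)" ?K "playable ?K"
  proof unfold_locales
    show "finite Y" "Y \<noteq> {}" "0 < k" "0 < n" using assms(4,6-8) by auto
    show "i < j \<and> j < N" if "(i, j) \<in> ?stk \<union> (\<Union>x\<in>Y. ?clk x)" for i j
      using constr_pos[OF that] all_constr_lt lt_pos[of i j] by blast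
    show "i = i' \<and> j = j'" if "(i, j) \<in> ?stk \<union> (\<Union>x\<in>Y. ?clk x)" "(i', j') \<in> ?stk \<union> (\<Union>x\<in>Y. ?clk x)"
      "{i, j} \<inter> {i', j'} \<noteq> {}" for i j i' j'
    proof -
      note ij = constr_pos[OF that(1)] and ij' = constr_pos[OF that(2)]
      then have N: "i < N" "j < N" "i' < N" "j' < N" by simp_all
      have "{pos i, pos j} \<inter> {pos i', pos j'} \<noteq> {}" using that(3) by auto
      then have "(pos i, pos j) = (pos i', pos j')" using unique ij ij' by blast
      then show ?thesis using N by (metis Pair_inject rank_pos)
    qed
    show "?stk \<inter> ?clk x = {}" if "x \<in> Y" for x
      using SC[OF _ that] unfolding pull_def by blast
    show "f (pos i) mod n = f (pos j) mod n" if "(i, j) \<in> ?stk" for i j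
      using that f(3) pos_in unfolding pull_def by fastforce
    show "j' < j" if ij: "(i, j) \<in> ?stk" "(i', j') \<in> ?stk" "f (pos i) mod n = f (pos i') mod n"
      "i < i'" "i' < j" for i j i' j'
    proof -
      obtain s s' where s: "s \<in> {1..n}" "s' \<in> {1..n}" "(pos i, pos j) \<in> S s" "(pos i', pos j') \<in> S s'"
        and N: "i < N" "j < N" "i' < N" "j' < N"
        using ij(1,2) unfolding pull_def by blast
      \<comment> \<open>Equal residues mean the same stack, since stacks are numbered from
        \<open>1\<close>; so well-nestedness of that one stack applies.\<close>
      have "s - 1 = s' - 1" using f(3)[OF s(1,3)] f(3)[OF s(2,4)] N ij(3) by (simp add: pos_in)
      then have "s = s'" using s(1,2) by auto
      then have "(pos j', pos j) \<in> lt W"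
        using bspec[OF nested s(1)] s N ij(4,5) lt_pos unfolding well_nested_def S_def by blast
      then show ?thesis using N lt_pos by blast
    qed
    show "\<exists>l. (m, l) \<in> ?clk x \<and> j' \<le> l \<and> l \<le> j"
      if "x \<in> Y" "(i, j) \<in> ?clk x" "(i', j') \<in> ?clk x" "i \<le> m" "m \<le> i'" "i' \<le> j" for x i j i' j' m
    proof (rule clock_timed_pull[OF _ _ _ that(2-6)])
      show "clock_timed W (C x)" using bspec[OF timed that(1)] by (simp add: C_def)
      show "C x \<subseteq> lt W" using C_sub[OF that(1)] all_constr_lt by blast
      show "single_valued (C x)" using unique C_sub[OF that(1)] by (intro single_valuedI) blast
    qed
    show "f (pos p) \<le> f (pos q)" if "p \<le> q" "q < N" for p q
      using that f(2) lt_pos[of p q] by (cases "p = q") auto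
    show "f (pos p) < k * n" if "p < N" for p using f(1) pos_in that by blast
    show "playable ?K {p}" if "p < N" for p
      using that K2 pos_in unfolding playable_def by (auto simp: links_def intro: splits.point)
    show "playable ?K {p, q}" if "(p, q) \<in> ?stk \<union> (\<Union>x\<in>Y. ?clk x)" for p q
    proof -
      have pq: "p < N" "q < N" "(pos p, pos q) \<in> all_constr W"
        using constr_pos[OF that] by simp_all
      then have "splits W ?K {pos p, pos q} {}" using K2 by (intro splits.pair)
      moreover have sub: "{p, q} \<subseteq> {..<N}" using pq by auto
      have "finite (links {p, q})"
        by (rule finite_subset[of _ "(\<lambda>p. (pos p, pos (Suc p))) ` {p, q}"]) (auto simp: links_def)
      \<comment> \<open>If the two positions are adjacent, a present edge joins them and is cut
        before the atom is reached.\<close>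
      ultimately have "splits W ?K {pos p, pos q} ({} \<union> links {p, q})"
        using links_subset[OF sub] by (intro splits_add_edges) auto
      then show ?thesis using sub by (simp add: playable_def)
    qed
    show "playable ?K (A \<union> B)"
      if AB: "A \<inter> B = {}" "(?stk \<union> (\<Union>x\<in>Y. ?clk x)) \<inter> (A \<times> B \<union> B \<times> A) = {}"
        "playable ?K A" "playable ?K B" "card (starts A) + card (starts B) \<le> ?K" for A B
    proof (rule playable_Un[OF AB(1,3,4) _ AB(5)])
      have "A \<subseteq> {..<N}" "B \<subseteq> {..<N}" using AB(3,4) by (auto simp: playable_def)
      then have "(pos p, pos q) \<notin> all_constr W" if "(p, q) \<in> A \<times> B \<union> B \<times> A" for p q
        using AB(2)[unfolded constrs] that by (auto simp: pull_def)
      then show "all_constr W \<inter> (pos ` A \<times> pos ` B \<union> pos ` B \<times> pos ` A) = {}"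
        by auto
    qed
  qed (rule max.cobounded1 max.cobounded2)+
  have "playable ?K {..<N}" using good_all W(1,3) by (simp add: card_gt_0_iff)
  then show ?thesis by (rule split_width_le_of_playable)
qed

end
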